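(* Let $B_w:X\to X$ be a hypercyclic weighted shift, where $X=\lambda^p(A)$ with $1\le p<\infty$ or $X=c_0(A)$. Suppose that $J\ge 1$ is such that for any $m\ge 1$ and any $j\ge 1$ there exists $m_j\ge 1$ such that $$\sup_{n\ge 0}\ \limsup_{k\to\infty}\frac{a_{j,k}\,a_{m,n+k}}{a_{J,k}\,a_{m_j,n+k}}<\infty.$$ Then $B_w$ possesses a hypercyclic subspace if and only if there exists $m\ge 1$ such that $$\sup_{n\ge 1}\inf_{k\ge 1}\frac{\prod_{\nu=1}^n|w_{\nu+k}|\,a_{J,k}}{a_{m,n+k}}\le 1,$$ or equivalently if and only if there exists $m\ge 1$ such that $$\sup_{n\ge 1}\inf_{k\ge 1}\frac{\prod_{\nu=1}^n|w_{\nu+k}|\,a_{J,k}}{a_{m,n+k}}<\infty.$$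
   Context: $A=(a_{j,k})_{j,k\ge 1}$ is a matrix with $a_{j,k}>0$ and $a_{j,k}\le a_{j+1,k}$ for all $j,k\ge1$, and $\mathbb{K}=\mathbb{R}$ or $\mathbb{C}$. The (real or complex) Köthe sequence spaces are $\lambda^p(A)=\{(x_k)_k\in\mathbb{K}^{\mathbb{N}}: p_j((x_k)_k)=(\sum_{k=1}^\infty|x_ka_{j,k}|^p)^{1/p}<\infty,\ j\ge1\}$ for $1\le p<\infty$, and $c_0(A)=\{(x_k)_k\in\mathbb{K}^{\mathbb{N}}:\lim_{k\to\infty}|x_k|a_{j,k}=0,\ j\ge1\}$ with $p_j((x_k)_k)=\max_k|x_k|a_{j,k}$; they are Fréchet spaces with the topology defined by the norms $(p_j)_{j\ge1}$. $(e_n)_{n\ge1}$ denotes the canonical unit sequences. For a sequence $w=(w_n)_{n\ge 1}$ of non-zero scalars, the weighted shift $B_w:X\to X$ is the continuous linear operator with $B_we_n=w_ne_{n-1}$ for $n\ge1$, where $e_0=0$. A vector $x$ is hypercyclic for $B_w$ if $\{B_w^nx:n\ge 1\}$ is dense in $X$; $B_w$ is hypercyclic if it has a hypercyclic vector. A hypercyclic subspace for $B_w$ is an infinite-dimensional closed linear subspace of $X$ in which every non-zero vector is hypercyclic for $B_w$. *)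

theory Defs
  imports "HOL-Analysis.Analysis" "HOL-Library.Function_Algebras"
begin

(*
  Index conventions. All indices j, m, J of the matrix and all positions k of sequences start
  at 0 instead of 1, so the entry a_{j,k} of the usual 1-based notation is "a (j-1) (k-1)" and
  w_k is "w (k-1)". Counters that are not positions keep their range: the number n of factors
  in the weight products, the exponent n of B^n and the shift n in a_{m,n+k}. All formulas
  a_{J,k}, a_{m,n+k}, w_{\<nu>+k} depend on k only through a translation, so they look the same.

  Scalars. The scalar field 'a ranges over {real_normed_field, euclidean_space}. Both real and
  complex are instances, and (Frobenius) every instance is isometrically isomorphic to one of them.
*)

global_interpretation seqs: vector_space "\<lambda>(c::'a::field) (x::nat \<Rightarrow> 'a) k. c * x k"
  defines seq_subspace = seqs.subspace and seq_span = seqs.span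
  by unfold_locales (auto simp: fun_eq_iff algebra_simps)

definition seminorm_topology ::
    "(nat \<Rightarrow> 'a::ab_group_add) set \<Rightarrow> (nat \<Rightarrow> (nat \<Rightarrow> 'a) \<Rightarrow> real) \<Rightarrow> (nat \<Rightarrow> 'a) topology" where
  "seminorm_topology X p =
     topology_generated_by {{y \<in> X. p j (y - x) < e} | j x e. x \<in> X \<and> e > 0}"

lemma topspace_seminorm_topology: "topspace (seminorm_topology X p) = X"
proof -
  let ?S = "{{y \<in> X. p j (y - x) < e} | j x e. x \<in> X \<and> e > 0}"
  have "X \<subseteq> \<Union>?S"
  proof
    fix y assume y: "y \<in> X"
    have "{z \<in> X. p 0 (z - y) < \<bar>p 0 (y - y)\<bar> + 1} \<in> ?S"
      using y by (intro CollectI exI[of _ 0] exI[of _ y] exI[of _ "\<bar>p 0 (y - y)\<bar> + 1"]) simp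
    moreover have "y \<in> {z \<in> X. p 0 (z - y) < \<bar>p 0 (y - y)\<bar> + 1}"
      using y by simp
    ultimately show "y \<in> \<Union>?S" by (rule UnionI)
  qed
  moreover have "\<Union>?S \<subseteq> X" by auto
  ultimately show ?thesis
    unfolding seminorm_topology_def topology_generated_by_topspace by (intro equalityI)
qed

definition koethe_matrix :: "(nat \<Rightarrow> nat \<Rightarrow> real) \<Rightarrow> bool" where
  "koethe_matrix a \<longleftrightarrow> (\<forall>j k. a j k > 0 \<and> a j k \<le> a (Suc j) k)"

definition lambda_set :: "real \<Rightarrow> (nat \<Rightarrow> nat \<Rightarrow> real) \<Rightarrow> (nat \<Rightarrow> 'a::real_normed_field) set" where
  "lambda_set p a = {x. \<forall>j. summable (\<lambda>k. (norm (x k) * a j k) powr p)}"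

definition lambda_norm ::
    "real \<Rightarrow> (nat \<Rightarrow> nat \<Rightarrow> real) \<Rightarrow> nat \<Rightarrow> (nat \<Rightarrow> 'a::real_normed_field) \<Rightarrow> real" where
  "lambda_norm p a j x = (\<Sum>k. (norm (x k) * a j k) powr p) powr (1 / p)"

definition c0_set :: "(nat \<Rightarrow> nat \<Rightarrow> real) \<Rightarrow> (nat \<Rightarrow> 'a::real_normed_field) set" where
  "c0_set a = {x. \<forall>j. (\<lambda>k. norm (x k) * a j k) \<longlonglongrightarrow> 0}"

(* On c0_set the supremum is attained, i.e. it is the maximum. *)
definition c0_norm ::
    "(nat \<Rightarrow> nat \<Rightarrow> real) \<Rightarrow> nat \<Rightarrow> (nat \<Rightarrow> 'a::real_normed_field) \<Rightarrow> real" where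
  "c0_norm a j x = (SUP k. norm (x k) * a j k)"

(* The Koethe sequence spaces as topological spaces; the underlying sets are their topspaces. *)
definition lambda_space ::
    "real \<Rightarrow> (nat \<Rightarrow> nat \<Rightarrow> real) \<Rightarrow> (nat \<Rightarrow> 'a::real_normed_field) topology" where
  "lambda_space p a = seminorm_topology (lambda_set p a) (lambda_norm p a)"

definition c0_space :: "(nat \<Rightarrow> nat \<Rightarrow> real) \<Rightarrow> (nat \<Rightarrow> 'a::real_normed_field) topology" where
  "c0_space a = seminorm_topology (c0_set a) (c0_norm a)"

definition unit_seq :: "nat \<Rightarrow> nat \<Rightarrow> 'a::zero_neq_one" where
  "unit_seq n = (\<lambda>k. if k = n then 1 else 0)"

(* B is only constrained on topspace X; linearity there is over the scalar field 'a. *)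
definition weighted_shift ::
    "(nat \<Rightarrow> 'a::real_normed_field) topology \<Rightarrow> (nat \<Rightarrow> 'a) \<Rightarrow> ((nat \<Rightarrow> 'a) \<Rightarrow> (nat \<Rightarrow> 'a)) \<Rightarrow> bool" where
  "weighted_shift X w B \<longleftrightarrow>
     (\<forall>n. w n \<noteq> 0) \<and>
     continuous_map X X B \<and>
     (\<forall>x\<in>topspace X. \<forall>y\<in>topspace X. B (x + y) = B x + B y) \<and>
     (\<forall>c. \<forall>x\<in>topspace X. B (\<lambda>k. c * x k) = (\<lambda>k. c * B x k)) \<and>
     B (unit_seq 0) = 0 \<and>
     (\<forall>n. B (unit_seq (Suc n)) = (\<lambda>k. w (Suc n) * unit_seq n k))"

definition hypercyclic_vector :: "'b topology \<Rightarrow> ('b \<Rightarrow> 'b) \<Rightarrow> 'b \<Rightarrow> bool" where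
  "hypercyclic_vector X B x \<longleftrightarrow>
     x \<in> topspace X \<and> X closure_of {(B ^^ n) x | n. n \<ge> 1} = topspace X"

definition hypercyclic :: "'b topology \<Rightarrow> ('b \<Rightarrow> 'b) \<Rightarrow> bool" where
  "hypercyclic X B \<longleftrightarrow> (\<exists>x. hypercyclic_vector X B x)"

definition hypercyclic_subspace ::
    "(nat \<Rightarrow> 'a::field) topology \<Rightarrow> ((nat \<Rightarrow> 'a) \<Rightarrow> (nat \<Rightarrow> 'a)) \<Rightarrow> (nat \<Rightarrow> 'a) set \<Rightarrow> bool" where
  "hypercyclic_subspace X B M \<longleftrightarrow>
     seq_subspace M \<and> closedin X M \<and>
     (\<nexists>S. finite S \<and> seq_span S = M) \<and>
     (\<forall>x\<in>M. x \<noteq> 0 \<longrightarrow> hypercyclic_vector X B x)"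

end

(* Write r(j,n,k) = p_j(B^n e_{n+k}). If the first condition fails, then for every m some power
   of B expands from p_m to p_J by a factor c > 1 on all unit vectors; composing such powers gives
   p_J(B^n x) >= C_n p_m(x) with C_n -> infinity for x supported on [n, infinity), and a gliding
   hump in any infinite-dimensional closed subspace M yields x in M with p_J(B^n x) >= 1 for all
   large n.
   If the second condition holds, hypercyclicity excludes that the infimum over k is governed by
   bounded k, and a growth argument using the hypothesis on J produces, for every N, infinitely
   many i such that p_j(B^s e_i) <= D_j p_{q(j)}(e_i) for all s, j <= N. Hence along suitable n_k,
   B^{n_k} tends to 0 on the closed span of some e_{i_l}; perturbing these e_{i_l} by small vectors
   that B^{n_k} maps onto a dense set of targets gives the hypercyclic subspace. *)

theory Submission
  imports Defs
begin

section \<open>Solid sequence cones\<close>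

text \<open>The obstacle in both directions is that every available step compares two different
  seminorms, so steps do not compose as they stand. When the first condition fails, only the step
  for \<open>m = J\<close> composes with itself; one more step for an auxiliary \<open>q\<close>,
  together with continuity of \<open>B\<close>, absorbs the remainder of \<open>n\<close> modulo the
  step length, and a last one reaches the given \<open>m\<close>. Under the second condition the
  steps have variable length and overshoot the position \<open>k\<close>; continuity turns the
  overshoot into a larger seminorm p_q at \<open>k\<close>, and the hypothesis on \<open>J\<close>
  converts p_q back to p_J there, at the price of replacing p_m by p_m' at the other end. Its
  constant must be uniform in the shift \<open>n\<close>, because \<open>n\<close> is chosen after
  that constant. The seminorms depend monotonically on the moduli of the coordinates, so comparisons
  on unit vectors extend to all vectors of suitable support; this is why lambda^p and c_0 can be
  treated at once.\<close>

definition tail :: "nat \<Rightarrow> (nat \<Rightarrow> 'b::zero) \<Rightarrow> nat \<Rightarrow> 'b" where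
  "tail n f = (\<lambda>k. if k < n then 0 else f k)"

text \<open>\<open>E\<close> stands for the positive cone of l^p or c_0 and \<open>\<nu>\<close> for
  its norm; the Koethe seminorms are \<open>\<nu>\<close> of the weighted moduli.
  \<open>tail_small\<close> rules out l^infinity, and \<open>series\<close> carries
  completeness.\<close>

locale solid_space =
  fixes E :: "(nat \<Rightarrow> real) set" and \<nu> :: "(nat \<Rightarrow> real) \<Rightarrow> real"
  assumes nonneg: "f \<in> E \<Longrightarrow> 0 \<le> f k"
    and solid: "g \<in> E \<Longrightarrow> (\<And>k. 0 \<le> f k) \<Longrightarrow> (\<And>k. f k \<le> g k) \<Longrightarrow> f \<in> E \<and> \<nu> f \<le> \<nu> g"
    and add: "f \<in> E \<Longrightarrow> g \<in> E \<Longrightarrow> (\<lambda>k. f k + g k) \<in> E \<and> \<nu> (\<lambda>k. f k + g k) \<le> \<nu> f + \<nu> g"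
    and scale: "f \<in> E \<Longrightarrow> 0 \<le> c \<Longrightarrow> (\<lambda>k. c * f k) \<in> E \<and> \<nu> (\<lambda>k. c * f k) = c * \<nu> f"
    and unit: "0 \<le> t \<Longrightarrow> (\<lambda>k. if k = i then t else 0) \<in> E \<and> \<nu> (\<lambda>k. if k = i then t else 0) = t"
    and tail_small: "f \<in> E \<Longrightarrow> 0 < e \<Longrightarrow> \<exists>n. \<nu> (tail n f) < e"
    and shift: "f \<in> E \<Longrightarrow> (\<lambda>k. f (k + n)) \<in> E \<and> \<nu> (\<lambda>k. f (k + n)) = \<nu> (tail n f)"
    and series: "(\<And>i. F i \<in> E) \<Longrightarrow> summable (\<lambda>i. \<nu> (F i)) \<Longrightarrow>
      (\<lambda>k. \<Sum>i. F i k) \<in> E \<and> \<nu> (\<lambda>k. \<Sum>i. F i k) \<le> (\<Sum>i. \<nu> (F i))"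
begin

lemma coord_le: "f \<in> E \<Longrightarrow> f k \<le> \<nu> f"
  using solid[of f "\<lambda>i. if i = k then f k else 0"] nonneg[of f] unit[of "f k" k] by auto

lemma norm_nonneg: "f \<in> E \<Longrightarrow> 0 \<le> \<nu> f"
  using coord_le[of f 0] nonneg[of f 0] by simp

lemma tail_mem: "f \<in> E \<Longrightarrow> tail n f \<in> E \<and> \<nu> (tail n f) \<le> \<nu> f"
  using solid[of f "tail n f"] nonneg[of f] by (auto simp: tail_def)

lemma tail_mono: "f \<in> E \<Longrightarrow> m \<le> n \<Longrightarrow> \<nu> (tail n f) \<le> \<nu> (tail m f)"
  using solid[of "tail m f" "tail n f"] nonneg[of f] tail_mem[of f m] by (auto simp: tail_def)

lemma tail_eventually_small:
  "f \<in> E \<Longrightarrow> 0 < e \<Longrightarrow> \<exists>n. \<forall>k\<ge>n. \<nu> (tail k f) < e"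
  using tail_small[of f e] tail_mono[of f] by (meson le_less_trans)

end

section \<open>The Minkowski inequality and the l^p cone\<close>

lemma powr_convex_nonneg:
  fixes p u v x y :: real
  assumes "p \<ge> 1" "0 \<le> x" "0 \<le> y" "0 \<le> u" "0 \<le> v" "u + v = 1"
  shows "(u * x + v * y) powr p \<le> u * x powr p + v * y powr p"
proof -
  \<comment> \<open>Serves the boundary cases \<open>x = 0\<close> and \<open>y = 0\<close>; inside,
    convexity on the positive half-line applies.\<close>
  have scaled: "(s * z) powr p \<le> s * z powr p" if "0 \<le> z" "0 \<le> s" "s \<le> 1" for s z :: real
  proof -
    have "s powr p \<le> s"
      using that assms(1) powr_mono'[of 1 p s] by (cases "s = 0") auto
    then show ?thesis
      using that by (simp add: powr_mult mult_right_mono)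
  qed
  consider "x = 0" | "y = 0" | "x > 0" "y > 0" using assms by linarith
  then show ?thesis
  proof cases
    case 3
    then show ?thesis
      using convex_onD[OF powr_convex[OF assms(1)], of v x y] assms(4,5,6)
      by (simp add: eq_diff_eq[symmetric])
  qed (use scaled[of y v] scaled[of x u] assms in auto)
qed

text \<open>Write \<open>f + g\<close> as \<open>s + t\<close> times the convex combination of
  \<open>f / s\<close> and \<open>g / t\<close> and apply convexity entrywise. Here \<open>s\<close>
  and \<open>t\<close> are positive upper bounds of the two norms, so that division is safe even if
  \<open>f\<close> or \<open>g\<close> vanishes; they are the norms plus \<open>e\<close>, and
  \<open>e\<close> tends to 0 at the end.\<close>

lemma lp_triangle:
  fixes f g :: "nat \<Rightarrow> real"
  assumes p: "p \<ge> 1" and f: "\<And>k. 0 \<le> f k" "summable (\<lambda>k. f k powr p)"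
    and g: "\<And>k. 0 \<le> g k" "summable (\<lambda>k. g k powr p)"
  shows "summable (\<lambda>k. (f k + g k) powr p)"
    and "(\<Sum>k. (f k + g k) powr p) powr (1 / p)
      \<le> (\<Sum>k. f k powr p) powr (1 / p) + (\<Sum>k. g k powr p) powr (1 / p)"
proof -
  have aux: "summable (\<lambda>k. (f k + g k) powr p) \<and> (\<Sum>k. (f k + g k) powr p) powr (1 / p) \<le> s + t"
    if s: "s > 0" "(\<Sum>k. f k powr p) \<le> s powr p" and t: "t > 0" "(\<Sum>k. g k powr p) \<le> t powr p" for s t
  proof -
    define u where "u = s / (s + t)"
    define v where "v = t / (s + t)"
    have uv: "u > 0" "v > 0" "u + v = 1"
      using s t by (auto simp: u_def v_def add_divide_distrib[symmetric])
    define h where "h = (\<lambda>k. (s + t) powr p * (u * (f k powr p / s powr p) + v * (g k powr p / t powr p)))"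
    have le: "(f k + g k) powr p \<le> h k" for k
    proof -
      have "(s + t) * u = s" "(s + t) * v = t"
        using s t by (auto simp: u_def v_def)
      then have "(s + t) * (u * (f k / s) + v * (g k / t)) = s * (f k / s) + t * (g k / t)"
        unfolding distrib_left mult.assoc[symmetric] by simp
      then have "f k + g k = (s + t) * (u * (f k / s) + v * (g k / t))"
        using s t by simp
      then have "(f k + g k) powr p = (s + t) powr p * (u * (f k / s) + v * (g k / t)) powr p"
        using s t uv f g by (simp add: powr_mult)
      also have "\<dots> \<le> (s + t) powr p * (u * (f k / s) powr p + v * (g k / t) powr p)"
        using s t uv f g p by (intro mult_left_mono powr_convex_nonneg) auto
      finally show ?thesis
        using s t f g by (simp add: h_def powr_divide)
    qed
    have sh: "summable h"
      unfolding h_def by (intro summable_mult summable_add summable_divide f g)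
    have sum: "summable (\<lambda>k. (f k + g k) powr p)"
      using le by (intro summable_comparison_test'[OF sh]) auto
    have "(\<Sum>k. (f k + g k) powr p) \<le> (\<Sum>k. h k)"
      by (intro suminf_le le sum sh)
    also have "\<dots> = (s + t) powr p * (u * ((\<Sum>k. f k powr p) / s powr p) + v * ((\<Sum>k. g k powr p) / t powr p))"
      unfolding h_def using f(2) g(2)
      by (simp add: suminf_mult suminf_add[symmetric] suminf_divide summable_mult summable_divide summable_add)
    also have "\<dots> \<le> (s + t) powr p * (u * 1 + v * 1)"
      using s t uv by (intro mult_left_mono add_mono) auto
    finally have "(\<Sum>k. (f k + g k) powr p) \<le> (s + t) powr p"
      using uv by simp
    then have "(\<Sum>k. (f k + g k) powr p) powr (1 / p) \<le> ((s + t) powr p) powr (1 / p)"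
      using p by (intro powr_mono2 suminf_nonneg sum) auto
    then show ?thesis
      using s t p sum by (simp add: powr_powr)
  qed
  let ?S = "(\<Sum>k. f k powr p) powr (1 / p)" and ?T = "(\<Sum>k. g k powr p) powr (1 / p)"
  have pos: "(\<Sum>k. f k powr p) \<le> (?S + e) powr p" "(\<Sum>k. g k powr p) \<le> (?T + e) powr p"
    if "e > 0" for e
  proof -
    have *: "z \<le> (z powr (1 / p) + e) powr p" if "z \<ge> 0" for z :: real
    proof -
      have "z = (z powr (1 / p)) powr p" using that p by (simp add: powr_powr)
      also have "\<dots> \<le> (z powr (1 / p) + e) powr p" using \<open>e > 0\<close> p by (intro powr_mono2) auto
      finally show ?thesis .
    qed
    show "(\<Sum>k. f k powr p) \<le> (?S + e) powr p" "(\<Sum>k. g k powr p) \<le> (?T + e) powr p"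
      using f g by (auto intro!: * suminf_nonneg)
  qed
  have gt: "?S + e > 0" "?T + e > 0" if "e > 0" for e
    using that by (auto intro: add_nonneg_pos)
  show "summable (\<lambda>k. (f k + g k) powr p)"
    using aux[OF gt(1) pos(1) gt(2) pos(2), of 1 1] by simp
  show "(\<Sum>k. (f k + g k) powr p) powr (1 / p) \<le> ?S + ?T"
  proof (rule field_le_epsilon)
    fix e :: real assume "e > 0"
    then show "(\<Sum>k. (f k + g k) powr p) powr (1 / p) \<le> ?S + ?T + e"
      using aux[OF gt(1) pos(1) gt(2) pos(2), of "e/2" "e/2"] by simp
  qed
qed

definition lp_cone :: "real \<Rightarrow> (nat \<Rightarrow> real) set" where
  "lp_cone p = {f. (\<forall>k. 0 \<le> f k) \<and> summable (\<lambda>k. f k powr p)}"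

definition lp_norm :: "real \<Rightarrow> (nat \<Rightarrow> real) \<Rightarrow> real" where
  "lp_norm p f = (\<Sum>k. f k powr p) powr (1 / p)"

lemma lp_norm_le_iff:
  assumes "p \<ge> 1" "f \<in> lp_cone p" "0 \<le> t"
  shows "lp_norm p f \<le> t \<longleftrightarrow> (\<Sum>k. f k powr p) \<le> t powr p"
proof -
  have nn: "0 \<le> (\<Sum>k. f k powr p)"
    using assms by (auto simp: lp_cone_def intro!: suminf_nonneg)
  have "lp_norm p f \<le> t \<longleftrightarrow> (lp_norm p f) powr p \<le> t powr p"
    using assms by (metis lp_norm_def less_le_trans linorder_not_le powr_ge_zero powr_less_mono2 powr_mono2 zero_less_one order_less_imp_le)
  then show ?thesis
    using nn assms by (simp add: lp_norm_def powr_powr)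
qed

lemma tail_powr: "(\<lambda>k. tail n f k powr p) = tail n (\<lambda>k. f k powr p)" for f :: "nat \<Rightarrow> real"
  by (auto simp: tail_def)

lemma sums_tail_iff:
  fixes f :: "nat \<Rightarrow> real"
  shows "tail n f sums s \<longleftrightarrow> (\<lambda>k. f (k + n)) sums s"
proof -
  have "(\<Sum>i<n. tail n f i) = 0" by (simp add: tail_def)
  then show ?thesis
    using sums_iff_shift'[of "tail n f" n s] by (simp add: tail_def)
qed

lemma solid_space_lp:
  assumes p: "p \<ge> 1"
  shows "solid_space (lp_cone p) (lp_norm p)"
proof
  fix f g :: "nat \<Rightarrow> real" and k
  show "f \<in> lp_cone p \<Longrightarrow> 0 \<le> f k" by (simp add: lp_cone_def)
  show "f \<in> lp_cone p \<and> lp_norm p f \<le> lp_norm p g"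
    if g: "g \<in> lp_cone p" and f: "\<And>k. 0 \<le> f k" "\<And>k. f k \<le> g k"
  proof -
    have le: "f k powr p \<le> g k powr p" for k
      using f p by (intro powr_mono2) auto
    have sf: "summable (\<lambda>k. f k powr p)"
    proof (rule summable_comparison_test')
      show "summable (\<lambda>k. g k powr p)" using g by (simp add: lp_cone_def)
      show "norm (f k powr p) \<le> g k powr p" if "k \<ge> 0" for k using le[of k] by simp
    qed
    have "(\<Sum>k. f k powr p) \<le> (\<Sum>k. g k powr p)"
      using g by (intro suminf_le[OF le sf]) (simp add: lp_cone_def)
    then show ?thesis
      using sf f p by (auto simp: lp_cone_def lp_norm_def intro!: powr_mono2 suminf_nonneg)
  qed
  show "(\<lambda>k. f k + g k) \<in> lp_cone p \<and> lp_norm p (\<lambda>k. f k + g k) \<le> lp_norm p f + lp_norm p g"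
    if "f \<in> lp_cone p" "g \<in> lp_cone p"
    using that lp_triangle[OF p, of f g] by (auto simp: lp_cone_def lp_norm_def)
  show "(\<lambda>k. c * f k) \<in> lp_cone p \<and> lp_norm p (\<lambda>k. c * f k) = c * lp_norm p f"
    if "f \<in> lp_cone p" "0 \<le> c" for c
  proof -
    have sf: "summable (\<lambda>k. f k powr p)" and f0: "\<And>k. 0 \<le> f k" using that by (auto simp: lp_cone_def)
    have "(\<lambda>k. (c * f k) powr p) = (\<lambda>k. c powr p * f k powr p)"
      using f0 that by (simp add: powr_mult)
    moreover have "(c powr p) powr (1 / p) = c"
      using p that by (simp add: powr_powr)
    ultimately show ?thesis
      using sf f0 that
      by (simp add: lp_cone_def lp_norm_def summable_mult suminf_mult suminf_nonneg powr_mult)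
  qed
next
  fix t :: real and i :: nat assume t: "0 \<le> t"
  have eq: "(\<lambda>k. (if k = i then t else 0) powr p) = (\<lambda>k. if k = i then t powr p else 0)" by auto
  show "(\<lambda>k. if k = i then t else 0) \<in> lp_cone p \<and> lp_norm p (\<lambda>k. if k = i then t else 0) = t"
    using t p sums_single[of i "\<lambda>_. t powr p"]
    by (auto simp: lp_cone_def lp_norm_def eq powr_powr sums_iff)
next
  fix f and n :: nat assume f: "f \<in> lp_cone p"
  then have sf: "summable (\<lambda>k. f k powr p)" by (simp add: lp_cone_def)
  have sums: "(\<lambda>k. tail n f k powr p) sums (\<Sum>k. f (k + n) powr p)" for n
    unfolding tail_powr sums_tail_iff using sf by (simp add: summable_sums summable_iff_shift[of "\<lambda>k. f k powr p"])
  show "(\<lambda>k. f (k + n)) \<in> lp_cone p \<and> lp_norm p (\<lambda>k. f (k + n)) = lp_norm p (tail n f)"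
    using f sums[of n] by (auto simp: lp_cone_def lp_norm_def sums_iff summable_iff_shift[of "\<lambda>k. f k powr p"])
  fix e :: real assume e: "0 < e"
  have "\<exists>n. (\<Sum>k. f (k + n) powr p) < e powr p"
  proof -
    obtain N where "\<forall>n\<ge>N. norm (\<Sum>i. f (i + n) powr p) < e powr p"
      using suminf_exist_split[OF _ sf, of "e powr p"] e by auto
    then have "norm (\<Sum>i. f (i + N) powr p) < e powr p" by blast
    then show ?thesis by (intro exI[of _ N]) simp
  qed
  then obtain n where n: "(\<Sum>k. f (k + n) powr p) < e powr p" by blast
  have "lp_norm p (tail n f) < (e powr p) powr (1 / p)"
    unfolding lp_norm_def sums_unique[OF sums[of n], symmetric] using n p sf
    by (intro powr_less_mono2) (auto intro!: suminf_nonneg simp: summable_iff_shift[of "\<lambda>k. f k powr p"])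
  then show "\<exists>n. lp_norm p (tail n f) < e"
    using e p by (auto simp: powr_powr)
next
  fix F :: "nat \<Rightarrow> nat \<Rightarrow> real"
  assume F: "\<And>i. F i \<in> lp_cone p" and sF: "summable (\<lambda>i. lp_norm p (F i))"
  define S where "S = (\<Sum>i. lp_norm p (F i))"
  have nn: "0 \<le> lp_norm p f" for f by (simp add: lp_norm_def)
  have S0: "0 \<le> S" using suminf_nonneg[OF sF] nn by (simp add: S_def)
  have coord: "F i k \<le> lp_norm p (F i)" for i k
  proof -
    have "F i k powr p \<le> (\<Sum>k. F i k powr p)"
      using F[of i] sum_le_suminf[of "\<lambda>k. F i k powr p" "{k}"] by (simp add: lp_cone_def)
    then have "(F i k powr p) powr (1 / p) \<le> lp_norm p (F i)"
      unfolding lp_norm_def using p by (intro powr_mono2) auto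
    then show ?thesis using p F[of i] by (simp add: lp_cone_def powr_powr)
  qed
  have F0: "0 \<le> F i k" for i k using F[of i] by (simp add: lp_cone_def)
  have sFk: "summable (\<lambda>i. F i k)" for k
    using F0 coord by (intro summable_comparison_test'[OF sF]) auto
  have part: "(\<lambda>k. \<Sum>i<L. F i k) \<in> lp_cone p \<and> lp_norm p (\<lambda>k. \<Sum>i<L. F i k) \<le> (\<Sum>i<L. lp_norm p (F i))" for L
  proof (induction L)
    case 0
    then show ?case using p by (simp add: lp_cone_def lp_norm_def)
  next
    case (Suc L)
    then show ?case
      using lp_triangle[OF p, of "\<lambda>k. \<Sum>i<L. F i k" "F L"] F[of L]
      by (auto simp: lp_cone_def lp_norm_def)
  qed
  \<comment> \<open>The limit in the number of summands is taken on finitely many coordinates, where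
    it is termwise. The bound does not depend on \<open>n\<close>, so the whole series over
    \<open>k\<close> inherits it.\<close>
  have fin: "(\<Sum>k<n. (\<Sum>i. F i k) powr p) \<le> S powr p" for n
  proof (rule tendsto_upperbound)
    show "(\<lambda>L. \<Sum>k<n. (\<Sum>i<L. F i k) powr p) \<longlonglongrightarrow> (\<Sum>k<n. (\<Sum>i. F i k) powr p)"
      using p F0 by (intro tendsto_sum tendsto_powr2 tendsto_const summable_LIMSEQ sFk)
        (auto intro!: always_eventually sum_nonneg)
    have "(\<Sum>k<n. (\<Sum>i<L. F i k) powr p) \<le> S powr p" for L
    proof -
      have "(\<Sum>i<L. lp_norm p (F i)) \<le> S"
        unfolding S_def by (intro sum_le_suminf sF) (auto simp: nn)
      then have "lp_norm p (\<lambda>k. \<Sum>i<L. F i k) \<le> S" using part[of L] by linarith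
      then have "(\<Sum>k. (\<Sum>i<L. F i k) powr p) \<le> S powr p"
        using lp_norm_le_iff[OF p _ S0] part[of L] by blast
      moreover have "(\<Sum>k<n. (\<Sum>i<L. F i k) powr p) \<le> (\<Sum>k. (\<Sum>i<L. F i k) powr p)"
        using part[of L] by (intro sum_le_suminf) (auto simp: lp_cone_def)
      ultimately show ?thesis by linarith
    qed
    then show "\<forall>\<^sub>F L in sequentially. (\<Sum>k<n. (\<Sum>i<L. F i k) powr p) \<le> S powr p"
      by simp
  qed simp
  have mem: "(\<lambda>k. \<Sum>i. F i k) \<in> lp_cone p"
    unfolding lp_cone_def
  proof (intro CollectI conjI allI)
    show "0 \<le> (\<Sum>i. F i k)" for k using F0 sFk by (intro suminf_nonneg)
    show "summable (\<lambda>k. (\<Sum>i. F i k) powr p)"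
      using fin by (intro summableI_nonneg_bounded[of _ "S powr p"]) auto
  qed
  have "(\<Sum>k. (\<Sum>i. F i k) powr p) \<le> S powr p"
    using mem fin by (intro suminf_le_const) (auto simp: lp_cone_def)
  then show "(\<lambda>k. \<Sum>i. F i k) \<in> lp_cone p \<and> lp_norm p (\<lambda>k. \<Sum>i. F i k) \<le> (\<Sum>i. lp_norm p (F i))"
    using mem lp_norm_le_iff[OF p mem S0] by (simp add: S_def)
qed

section \<open>The c_0 cone\<close>

definition c0_cone :: "(nat \<Rightarrow> real) set" where
  "c0_cone = {f. (\<forall>k. 0 \<le> f k) \<and> f \<longlonglongrightarrow> 0}"

definition sup_norm :: "(nat \<Rightarrow> real) \<Rightarrow> real" where
  "sup_norm f = (SUP k. f k)"

lemma bdd_above_c0: "f \<in> c0_cone \<Longrightarrow> bdd_above (range f)"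
  using convergentI[of f 0] by (simp add: c0_cone_def convergent_imp_Bseq Bseq_bdd_above)

lemma sup_norm_upper: "f \<in> c0_cone \<Longrightarrow> f k \<le> sup_norm f"
  by (auto simp: sup_norm_def intro: cSUP_upper bdd_above_c0)

lemma sup_norm_least: "(\<And>k. f k \<le> t) \<Longrightarrow> sup_norm f \<le> t"
  by (auto simp: sup_norm_def intro: cSUP_least)

lemma solid_space_c0: "solid_space c0_cone sup_norm"
proof
  fix f g :: "nat \<Rightarrow> real" and k
  show "f \<in> c0_cone \<Longrightarrow> 0 \<le> f k" by (simp add: c0_cone_def)
  show "f \<in> c0_cone \<and> sup_norm f \<le> sup_norm g"
    if g: "g \<in> c0_cone" and f: "\<And>k. 0 \<le> f k" "\<And>k. f k \<le> g k"
  proof -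
    have "f \<longlonglongrightarrow> 0"
      using g f by (intro tendsto_sandwich[of "\<lambda>_. 0" f sequentially g]) (auto simp: c0_cone_def)
    then show ?thesis
      using f sup_norm_upper[OF g] by (auto simp: c0_cone_def intro!: sup_norm_least intro: order_trans)
  qed
  show "(\<lambda>k. f k + g k) \<in> c0_cone \<and> sup_norm (\<lambda>k. f k + g k) \<le> sup_norm f + sup_norm g"
    if fg: "f \<in> c0_cone" "g \<in> c0_cone"
    using sup_norm_upper[OF fg(1)] sup_norm_upper[OF fg(2)] fg tendsto_add[of f 0 sequentially g 0]
    by (auto simp: c0_cone_def intro!: sup_norm_least add_mono)
  show "(\<lambda>k. c * f k) \<in> c0_cone \<and> sup_norm (\<lambda>k. c * f k) = c * sup_norm f"
    if f: "f \<in> c0_cone" and c: "0 \<le> c" for c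
  proof -
    have mem: "(\<lambda>k. c * f k) \<in> c0_cone"
      using f c tendsto_mult_left[of f 0 sequentially c] by (auto simp: c0_cone_def)
    have "c * sup_norm f \<le> sup_norm (\<lambda>k. c * f k)"
    proof (cases "c = 0")
      case True
      then show ?thesis using sup_norm_upper[OF mem, of 0] by simp
    next
      case False
      then have "sup_norm f \<le> sup_norm (\<lambda>k. c * f k) / c"
        using c sup_norm_upper[OF mem] by (intro sup_norm_least) (simp add: field_simps)
      then show ?thesis using False c by (simp add: field_simps)
    qed
    moreover have "sup_norm (\<lambda>k. c * f k) \<le> c * sup_norm f"
      using c sup_norm_upper[OF f] by (intro sup_norm_least mult_left_mono)
    ultimately show ?thesis using mem by simp
  qed
next
  fix t :: real and i :: nat assume t: "0 \<le> t"
  have "\<forall>\<^sub>F k in sequentially. (if k = i then t else 0) = 0"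
    using eventually_gt_at_top[of i] by (rule eventually_mono) simp
  then have "(\<lambda>k. if k = i then t else 0) \<longlonglongrightarrow> 0"
    by (rule tendsto_eventually)
  then have mem: "(\<lambda>k. if k = i then t else 0) \<in> c0_cone"
    using t by (simp add: c0_cone_def)
  show "(\<lambda>k. if k = i then t else 0) \<in> c0_cone \<and> sup_norm (\<lambda>k. if k = i then t else 0) = t"
    using mem sup_norm_upper[OF mem, of i] t by (auto intro!: antisym sup_norm_least)
next
  fix f and n :: nat assume f: "f \<in> c0_cone"
  have tl: "tail n f \<in> c0_cone" for n
  proof -
    have ev: "\<forall>\<^sub>F k in sequentially. f k = tail n f k"
      using eventually_ge_at_top[of n] by (rule eventually_mono) (simp add: tail_def)
    have "f \<longlonglongrightarrow> 0" using f by (simp add: c0_cone_def)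
    then have "tail n f \<longlonglongrightarrow> 0" using ev by (rule Lim_transform_eventually)
    then show ?thesis using f by (auto simp: c0_cone_def tail_def)
  qed
  have sh: "(\<lambda>k. f (k + n)) \<in> c0_cone"
    using f LIMSEQ_ignore_initial_segment[of f 0 n] by (auto simp: c0_cone_def)
  have "tail n f k \<le> sup_norm (\<lambda>k. f (k + n))" for k
    using sup_norm_upper[OF sh, of "k - n"] sup_norm_upper[OF sh, of 0] f
    by (auto simp: tail_def c0_cone_def intro: order_trans)
  moreover have "f (k + n) \<le> sup_norm (tail n f)" for k
    using sup_norm_upper[OF tl[of n], of "k + n"] by (simp add: tail_def)
  ultimately show "(\<lambda>k. f (k + n)) \<in> c0_cone \<and> sup_norm (\<lambda>k. f (k + n)) = sup_norm (tail n f)"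
    using sh by (auto intro!: antisym sup_norm_least)
  fix e :: real assume e: "0 < e"
  then obtain n where "\<And>k. k \<ge> n \<Longrightarrow> \<bar>f k\<bar> < e / 2"
    using f LIMSEQ_D[of f 0 "e / 2"] by (auto simp: c0_cone_def)
  then have "f k \<le> e / 2" if "k \<ge> n" for k using that abs_less_iff less_imp_le by blast
  then have "sup_norm (tail n f) \<le> e / 2"
    using e by (intro sup_norm_least) (simp add: tail_def)
  then show "\<exists>n. sup_norm (tail n f) < e"
    using e by (intro exI[of _ n]) simp
next
  fix F :: "nat \<Rightarrow> nat \<Rightarrow> real"
  assume F: "\<And>i. F i \<in> c0_cone" and sF: "summable (\<lambda>i. sup_norm (F i))"
  have F0: "0 \<le> F i k" for i k using F[of i] by (simp add: c0_cone_def)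
  have sFk: "summable (\<lambda>i. F i k)" for k
    using F0 sup_norm_upper[OF F] by (intro summable_comparison_test'[OF sF]) auto
  \<comment> \<open>Dominated convergence for series, with the summable majorant
    \<open>sup_norm (F i)\<close>.\<close>
  have "(\<lambda>k. \<Sum>i. F i k) \<longlonglongrightarrow> (\<Sum>i. 0 :: real)"
    using F F0 sup_norm_upper[OF F]
    by (intro conjunct2[OF conjunct2[OF tannerys_theorem[where M = "\<lambda>i. sup_norm (F i)" and F = sequentially]]])
      (auto simp: c0_cone_def sF intro!: always_eventually)
  then have "(\<lambda>k. \<Sum>i. F i k) \<in> c0_cone"
    using F0 sFk by (auto simp: c0_cone_def intro!: suminf_nonneg)
  then show "(\<lambda>k. \<Sum>i. F i k) \<in> c0_cone \<and> sup_norm (\<lambda>k. \<Sum>i. F i k) \<le> (\<Sum>i. sup_norm (F i))"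
    by (auto intro!: sup_norm_least suminf_le sup_norm_upper F sF sFk)
qed

section \<open>Growth of the weights\<close>

text \<open>The scalar part of the argument: \<open>v\<close> is the modulus of the weights, and
  \<open>weight_bounded\<close> is the continuity of the shift tested on unit vectors.\<close>

locale weight_matrix =
  fixes a :: "nat \<Rightarrow> nat \<Rightarrow> real" and v :: "nat \<Rightarrow> real"
  assumes matrix: "koethe_matrix a"
    and weight_pos: "0 < v k"
    and weight_bounded: "\<exists>q D. \<forall>k. v (Suc k) * a j k \<le> D * a q (Suc k)"
begin

text \<open>\<open>W n k * a j k\<close> is the j-th seminorm of the n-th iterate applied to the
  unit vector at \<open>n + k\<close>. \<open>W_add\<close> below is the cocycle rule: of
  \<open>m + n\<close> steps, the first \<open>n\<close> lead from \<open>m + n + k\<close> to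
  \<open>m + k\<close>.\<close>

definition W :: "nat \<Rightarrow> nat \<Rightarrow> real" where
  "W n k = (\<Prod>\<mu>=1..n. v (\<mu> + k))"

lemma a_pos: "0 < a j k" using matrix by (simp add: koethe_matrix_def)

lemma a_mono: "i \<le> j \<Longrightarrow> a i k \<le> a j k"
  using matrix lift_Suc_mono_le[of "\<lambda>j. a j k" i j] by (simp add: koethe_matrix_def)

lemma W_pos: "0 < W n k" by (simp add: W_def weight_pos prod_pos)

lemma W_0 [simp]: "W 0 k = 1" by (simp add: W_def)

lemma W_add: "W (m + n) k = W m k * W n (m + k)"
proof -
  have "(\<Prod>\<mu>=1..m + n. v (\<mu> + k)) = (\<Prod>\<mu>=1..m. v (\<mu> + k)) * (\<Prod>\<mu>=m + 1..m + n. v (\<mu> + k))"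
    using prod.ub_add_nat[of 1 m "\<lambda>\<mu>. v (\<mu> + k)" n] by simp
  also have "(\<Prod>\<mu>=m + 1..m + n. v (\<mu> + k)) = (\<Prod>\<mu>=1..n. v (\<mu> + (m + k)))"
    using prod.shift_bounds_cl_nat_ivl[of "\<lambda>\<mu>. v (\<mu> + k)" 1 m n] by (simp add: ac_simps)
  finally show ?thesis by (simp add: W_def)
qed

lemma W_Suc: "W (Suc n) k = W n k * v (Suc (n + k))"
  by (simp add: W_def)

lemma iterate_bounded: "\<exists>q D. 0 < D \<and> (\<forall>s\<le>N. \<forall>k. W s k * a j k \<le> D * a q (s + k))"
proof (induction N)
  case 0
  then show ?case by (intro exI[of _ j] exI[of _ 1]) simp
next
  case (Suc N)
  then obtain q D where D: "0 < D" "\<And>s k. s \<le> N \<Longrightarrow> W s k * a j k \<le> D * a q (s + k)" by blast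
  obtain q' D' where D': "\<And>k. v (Suc k) * a q k \<le> D' * a q' (Suc k)"
    using weight_bounded by blast
  let ?D = "max D (D * D')" and ?q = "max q q'"
  have pos: "0 < ?D" using D by simp
  have le: "D * a q k \<le> ?D * a ?q k" "D * D' * a q' k \<le> ?D * a ?q k" for k
    using pos by (auto intro!: mult_mono a_mono less_imp_le[OF a_pos])
  have "W s k * a j k \<le> ?D * a ?q (s + k)" if s: "s \<le> Suc N" for s k
  proof (cases "s \<le> N")
    case True
    then show ?thesis using D(2)[of s k] le(1)[of "s + k"] by linarith
  next
    case False
    with s have s: "s = Suc N" by simp
    have "W s k * a j k = v (Suc (N + k)) * (W N k * a j k)" by (simp add: s W_Suc)
    also have "\<dots> \<le> v (Suc (N + k)) * (D * a q (N + k))"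
      using weight_pos by (intro mult_left_mono D) (auto simp: less_imp_le)
    also have "\<dots> = D * (v (Suc (N + k)) * a q (N + k))" by simp
    also have "\<dots> \<le> D * (D' * a q' (Suc (N + k)))"
      using D(1) by (intro mult_left_mono D') auto
    also have "\<dots> \<le> ?D * a ?q (s + k)" using le(2)[of "s + k"] by (simp add: s)
    finally show ?thesis .
  qed
  then show ?case using pos by blast
qed

text \<open>The set \<open>S\<close> is \<open>{0}\<close> when the estimates are uniform in \<open>k\<close>, and \<open>UNIV\<close> when they
  are asymptotic in \<open>k\<close>.\<close>

lemma weight_growth:
  assumes S: "\<And>x y. x \<in> S \<Longrightarrow> y \<in> S \<Longrightarrow> max x y \<in> S"
    and jump: "\<And>m. \<exists>n\<ge>1. \<exists>c>1. \<exists>K\<in>S. \<forall>k\<ge>K. c * a m (n + k) \<le> W n k * a J k"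
    and C: "0 < C"
  shows "\<exists>N. \<exists>K\<in>S. \<forall>n\<ge>N. \<forall>k\<ge>K. C * a m (n + k) \<le> W n k * a J k"
proof -
  \<comment> \<open>The step \<open>n0\<close> leads from the seminorm \<open>J\<close> to itself
    and can be iterated; it produces the growth. The steps \<open>n1\<close> (from \<open>q\<close>)
    and \<open>n2\<close> (from \<open>m\<close>) are each used once, to change seminorms.\<close>
  obtain n0 c K0 where n0: "n0 \<ge> 1" "c > 1" "K0 \<in> S"
    and j0: "\<And>k. k \<ge> K0 \<Longrightarrow> c * a J (n0 + k) \<le> W n0 k * a J k"
    using jump[of J] by blast
  obtain q D where D: "0 < D" "\<And>s k. s \<le> n0 \<Longrightarrow> W s k * a J k \<le> D * a q (s + k)"
    using iterate_bounded[of n0 J] by blast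
  obtain n1 c1 K1 where n1: "c1 > 1" "K1 \<in> S"
    and j1: "\<And>k. k \<ge> K1 \<Longrightarrow> c1 * a q (n1 + k) \<le> W n1 k * a J k"
    using jump[of q] by blast
  obtain n2 c2 K2 where n2: "c2 > 1" "K2 \<in> S"
    and j2: "\<And>k. k \<ge> K2 \<Longrightarrow> c2 * a m (n2 + k) \<le> W n2 k * a J k"
    using jump[of m] by blast
  define K where "K = max K0 (max K1 K2)"
  have K: "K \<in> S" "K0 \<le> K" "K1 \<le> K" "K2 \<le> K"
    using S n0 n1 n2 by (auto simp: K_def)
  have j1': "a q (n1 + k) \<le> W n1 k * a J k" if "k \<ge> K" for k
    using order_trans[OF _ j1[of k]] that K n1 a_pos[of q "n1 + k"] by simp
  have j2': "a m (n2 + k) \<le> W n2 k * a J k" if "k \<ge> K" for k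
    using order_trans[OF _ j2[of k]] that K n2 a_pos[of m "n2 + k"] by simp
  have pow: "c ^ l * a J (l * n0 + k) \<le> W (l * n0) k * a J k" if "k \<ge> K" for l k
  proof (induction l)
    case (Suc l)
    have "c ^ Suc l * a J (Suc l * n0 + k) = c ^ l * (c * a J (n0 + (l * n0 + k)))"
      by (simp add: ac_simps)
    also have "\<dots> \<le> c ^ l * (W n0 (l * n0 + k) * a J (l * n0 + k))"
      using that K n0 by (intro mult_left_mono j0) auto
    also have "\<dots> = W n0 (l * n0 + k) * (c ^ l * a J (l * n0 + k))" by simp
    also have "\<dots> \<le> W n0 (l * n0 + k) * (W (l * n0) k * a J k)"
      using W_pos by (intro mult_left_mono Suc.IH) (auto simp: less_imp_le)
    also have "\<dots> = W (Suc l * n0) k * a J k"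
      using W_add[of "l * n0" n0 k] by (simp add: ac_simps)
    finally show ?case .
  qed simp
  obtain L where L: "C * D < c ^ L" using real_arch_pow[of c "C * D"] n0 by blast
  have main: "C * a m (n + k) \<le> W n k * a J k"
    if n: "n \<ge> Suc L * n0 + n1 + n2" and k: "k \<ge> K" for n k
  proof -
    \<comment> \<open>The path from \<open>n + k\<close> down to \<open>k\<close> consists of the
      step \<open>n2\<close> down to \<open>z\<close>, a remainder \<open>s\<close> down to
      \<open>y\<close>, the step \<open>n1\<close> down to \<open>x\<close>, and \<open>l\<close>
      growth steps. Starting from \<open>Suc L\<close> steps gives the factor \<open>C * D\<close>
      and also \<open>l \<ge> 1\<close>, hence room below \<open>y\<close> for the next
      estimate.\<close>
    define l where "l = (n - n1 - n2) div n0"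
    define s where "s = (n - n1 - n2) mod n0"
    have nn: "n = l * n0 + (n1 + (s + n2))"
      using n by (simp add: l_def s_def)
    have s: "s \<le> n0" using n0 by (simp add: s_def less_imp_le)
    have "Suc L * n0 \<le> n - n1 - n2" using n by linarith
    then have lL: "Suc L \<le> l"
      using n0 div_le_mono[of "Suc L * n0" "n - n1 - n2" n0] by (simp add: l_def)
    define x y z where "x = l * n0 + k" and "y = n1 + x" and "z = s + y"
    have Wn: "W n k = W (l * n0) k * (W n1 x * (W s y * W n2 z))"
      unfolding nn W_add x_def y_def z_def by (simp add: ac_simps)
    have ge: "x \<ge> K" "y \<ge> K" "z \<ge> K" using k by (auto simp: x_def y_def z_def)
    have e1: "c ^ l * a J x \<le> W (l * n0) k * a J k" using pow[OF k] by (simp add: x_def)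
    have e2: "a q y \<le> W n1 x * a J x" using j1'[OF ge(1)] by (simp add: y_def)
    have e5: "a m (n2 + z) \<le> W n2 z * a J z" using j2'[OF ge(3)] .
    \<comment> \<open>The remainder \<open>s\<close> need not expand anything by itself. It is
      prolonged below \<open>y\<close> to a full step of length \<open>n0\<close>, which does
      expand; the added \<open>n0 - s\<close> steps cost at most the factor \<open>D\<close> and the
      passage from \<open>J\<close> to \<open>q\<close>.\<close>
    have e3: "a J z \<le> W s y * (D * a q y)"
    proof -
      define k' where "k' = y - (n0 - s)"
      have "1 * n0 \<le> l * n0" using lL by (intro mult_le_mono1) simp
      then have "n0 + K \<le> x" using add_mono[of n0 "l * n0" K k] k by (simp add: x_def)
      then have k': "k' \<ge> K0" "z = n0 + k'" "y = (n0 - s) + k'" "n0 = (n0 - s) + s"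
        using s K by (auto simp: k'_def z_def y_def)
      have "a J z \<le> c * a J z" using n0 a_pos[of J z] by simp
      also have "\<dots> \<le> W n0 k' * a J k'" using j0[OF k'(1)] k' by simp
      also have "\<dots> = W s y * (W (n0 - s) k' * a J k')"
        using W_add[of "n0 - s" s k'] k' by simp
      also have "\<dots> \<le> W s y * (D * a q y)"
        using W_pos D(2)[of "n0 - s" k'] k'(3) by (intro mult_left_mono) (auto simp: less_imp_le)
      finally show ?thesis .
    qed
    have "c ^ L \<le> c ^ l" using lL n0 by (intro power_increasing) auto
    then have CD: "C * D \<le> c ^ l" using L by simp
    have "C * a m (n + k) = C * a m (n2 + z)"
      by (simp add: nn x_def y_def z_def ac_simps)
    also have "\<dots> \<le> C * (W n2 z * a J z)"
      using C e5 by simp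
    also have "\<dots> \<le> C * (W n2 z * (W s y * (D * a q y)))"
      using C e3 W_pos by simp
    also have "\<dots> \<le> C * (W n2 z * (W s y * (D * (W n1 x * a J x))))"
      using C e2 W_pos D(1) by simp
    also have "\<dots> = (W n2 z * W s y * W n1 x) * ((C * D) * a J x)"
      by simp
    also have "\<dots> \<le> (W n2 z * W s y * W n1 x) * (c ^ l * a J x)"
      using CD W_pos a_pos by (intro mult_left_mono mult_right_mono) (auto simp: less_imp_le)
    also have "\<dots> \<le> (W n2 z * W s y * W n1 x) * (W (l * n0) k * a J k)"
      using e1 W_pos by (intro mult_left_mono) (auto simp: less_imp_le)
    also have "\<dots> = W n k * a J k" by (simp add: Wn)
    finally show ?thesis .
  qed
  show ?thesis
    using main K(1) by blast
qed

text \<open>If every \<open>m'\<close> failed, \<open>weight_growth\<close> in its asymptotic form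
  would give \<open>C' * a m (n + k) \<le> W n k * a J k\<close> for all \<open>n \<ge> N\<close>
  and \<open>k \<ge> K\<close>, with \<open>C' > C\<close>. By \<open>escape\<close> some such
  \<open>n\<close> also satisfies this for the finitely many \<open>k < K\<close>, so no
  \<open>k\<close> is left for \<open>B\<close>.\<close>

lemma recurrent_bound:
  assumes B: "\<And>n. n \<ge> 1 \<Longrightarrow> \<exists>k. W n k * a J k \<le> C * a m (n + k)"
    and escape: "\<And>K j e N. 0 < e \<Longrightarrow> \<exists>n\<ge>N. \<forall>k<K. a j (n + k) \<le> e * W n k"
  obtains m' where "\<And>n K. n \<ge> 1 \<Longrightarrow> \<exists>k\<ge>K. W n k * a J k \<le> 2 * a m' (n + k)"
proof (rule ccontr)
  assume no: "\<not> thesis"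
  have jump: "\<exists>n\<ge>1. \<exists>c>1. \<exists>K\<in>UNIV. \<forall>k\<ge>K. c * a m' (n + k) \<le> W n k * a J k" for m'
  proof -
    have "\<not> (\<forall>n K. n \<ge> 1 \<longrightarrow> (\<exists>k\<ge>K. W n k * a J k \<le> 2 * a m' (n + k)))"
      using no that by blast
    then obtain n K where "n \<ge> 1" "\<forall>k\<ge>K. 2 * a m' (n + k) \<le> W n k * a J k"
      by (meson linear)
    then show ?thesis by (intro exI[of _ n] conjI exI[of _ "2::real"]) auto
  qed
  define C' where "C' = max C 0 + 1"
  have C': "0 < C'" "C < C'" by (auto simp: C'_def)
  obtain N K where NK: "\<And>n k. n \<ge> N \<Longrightarrow> k \<ge> K \<Longrightarrow> C' * a m (n + k) \<le> W n k * a J k"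
    using weight_growth[of UNIV, OF _ jump C'(1), of m] by blast
  have low: "\<exists>e>0. \<forall>k<K. C' * e \<le> a J k" for K
  proof (induction K)
    case (Suc K)
    then obtain e where e: "e > 0" "\<forall>k<K. C' * e \<le> a J k" by blast
    define e' where "e' = min e (a J K / C')"
    have "e' > 0" using e C' a_pos[of J K] by (simp add: e'_def)
    moreover have "C' * e' \<le> C' * e" "C' * e' \<le> C' * (a J K / C')"
      unfolding e'_def using C' by (intro mult_left_mono; simp)+
    moreover have "C' * (a J K / C') = a J K" using C' by simp
    ultimately show ?case using e by (intro exI[of _ e']) (auto simp: less_Suc_eq intro: order_trans)
  qed (auto intro: exI[of _ 1])
  obtain e where e: "e > 0" "\<forall>k<K. C' * e \<le> a J k" using low by blast
  obtain n where n: "n \<ge> max 1 N" "\<And>k. k < K \<Longrightarrow> a m (n + k) \<le> e * W n k"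
    using escape[OF e(1)] by blast
  obtain k where k: "W n k * a J k \<le> C * a m (n + k)" using B[of n] n by auto
  also have "\<dots> < C' * a m (n + k)" using C' a_pos by simp
  finally have lt: "W n k * a J k < C' * a m (n + k)" .
  then have "k < K" using NK[of n k] n by force
  then have "C' * a m (n + k) \<le> C' * (e * W n k)" using n C' by simp
  also have "\<dots> = W n k * (C' * e)" by simp
  also have "\<dots> \<le> W n k * a J k"
    using e \<open>k < K\<close> W_pos by (intro mult_left_mono) (auto simp: less_imp_le)
  finally show False using lt by simp
qed

text \<open>If the conclusion failed for every \<open>m\<close>, then from every large position some step of
  length at most \<open>N0\<close> would double the \<open>J\<close>-norm, so the norms along the orbit would grow like
  \<open>\<beta> ^ n\<close>. Hypothesis \<open>H\<close> converts the growth in the norm \<open>q\<close>, which absorbs the overshoot of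
  the last step, back to the norm \<open>J\<close>.\<close>

lemma simultaneous_bound:
  assumes R: "\<And>n K. n \<ge> 1 \<Longrightarrow> \<exists>k\<ge>K. W n k * a J k \<le> 2 * a m (n + k)"
    and H: "\<And>j. \<exists>m' C. \<forall>n. \<exists>K. \<forall>k\<ge>K. a j k * a m (n + k) \<le> C * (a J k * a m' (n + k))"
  obtains m' where "\<And>N K. \<exists>i\<ge>K. \<forall>s\<le>N. s \<le> i \<longrightarrow> W s (i - s) * a J (i - s) \<le> 2 * a m' i"
proof (rule ccontr)
  assume no: "\<not> thesis"
  have "\<exists>N\<ge>1. \<exists>K. \<forall>i\<ge>K. \<exists>s. s \<le> N \<and> s \<le> i \<and> 2 * a m' i \<le> W s (i - s) * a J (i - s)" for m'
  proof -
    have "\<not> (\<forall>N K. \<exists>i\<ge>K. \<forall>s\<le>N. s \<le> i \<longrightarrow> W s (i - s) * a J (i - s) \<le> 2 * a m' i)"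
      using no that by blast
    then obtain N K where "\<forall>i\<ge>K. \<exists>s. s \<le> N \<and> s \<le> i \<and> 2 * a m' i \<le> W s (i - s) * a J (i - s)"
      by (meson linear)
    then have "\<forall>i\<ge>K. \<exists>s. s \<le> max 1 N \<and> s \<le> i \<and> 2 * a m' i \<le> W s (i - s) * a J (i - s)"
      by (meson max.cobounded2 order_trans)
    then show ?thesis by (meson max.cobounded1)
  qed
  then have jump: "\<exists>N\<ge>1. \<exists>K. \<forall>i\<ge>K. \<exists>s. s \<le> N \<and> s \<le> i \<and> 2 * a m' i \<le> W s (i - s) * a J (i - s)" for m'
    by blast
  obtain N0 K0 where N0: "N0 \<ge> 1"
    and j0: "\<And>i. i \<ge> K0 \<Longrightarrow> \<exists>s. s \<le> N0 \<and> s \<le> i \<and> 2 * a J i \<le> W s (i - s) * a J (i - s)"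
    using jump[of J] by metis
  obtain q D where D: "0 < D" "\<And>s k. s \<le> N0 \<Longrightarrow> W s k * a J k \<le> D * a q (s + k)"
    using iterate_bounded[of N0 J] by blast
  obtain m' C where C: "\<And>n. \<exists>K. \<forall>k\<ge>K. a q k * a m (n + k) \<le> C * (a J k * a m' (n + k))"
    using H[of q] by blast
  obtain N2 K2 where N2: "N2 \<ge> 1"
    and j2: "\<And>i. i \<ge> K2 \<Longrightarrow> \<exists>s. s \<le> N2 \<and> s \<le> i \<and> 2 * a m' i \<le> W s (i - s) * a J (i - s)"
    using jump[of m'] by metis
  \<comment> \<open>Chosen so that a doubling step of any length \<open>s \<le> N0\<close> gains at
    least \<open>\<beta> ^ s\<close>.\<close>
  define \<beta> :: real where "\<beta> = 2 powr (1 / N0)"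
  have \<beta>: "1 < \<beta>" using N0 by (simp add: \<beta>_def)
  have \<beta>_pow: "\<beta> ^ s \<le> 2" if "s \<le> N0" for s
  proof -
    have "\<beta> ^ s \<le> \<beta> ^ N0" using \<beta> that by (intro power_increasing) auto
    also have "\<dots> = 2" using N0 by (simp add: \<beta>_def powr_realpow[symmetric] powr_powr)
    finally show ?thesis .
  qed
  \<comment> \<open>The total length cannot be prescribed exactly, as the steps have varying
    lengths; it can be kept within \<open>N0\<close> of any given \<open>n\<close>. A doubling step
    has positive length, so the chain advances.\<close>
  have chain: "\<exists>s. n \<le> s \<and> s \<le> n + N0 \<and> \<beta> ^ s * a J i \<le> W s (i - s) * a J (i - s)"
    if "i \<ge> n + K0 + N0" for n i
    using that
  proof (induction n)
    case 0
    then show ?case by (intro exI[of _ 0]) simp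
  next
    case (Suc n)
    obtain s where s: "n \<le> s" "s \<le> n + N0" "\<beta> ^ s * a J i \<le> W s (i - s) * a J (i - s)"
      using Suc by auto
    show ?case
    proof (cases "s = n")
      case False
      then show ?thesis using s by (intro exI[of _ s]) auto
    next
      case True
      obtain t where t: "t \<le> N0" "t \<le> i - n"
          "2 * a J (i - n) \<le> W t (i - n - t) * a J (i - n - t)"
        using j0[of "i - n"] Suc.prems by (metis Suc_leD add_leD1 le_diff_conv2 add.commute add_Suc)
      have "t \<noteq> 0" using t(3) a_pos[of J "i - n"] by (intro notI) simp
      have "\<beta> ^ (n + t) * a J i \<le> 2 * (\<beta> ^ n * a J i)"
        using \<beta>_pow[OF t(1)] \<beta> a_pos[of J i] by (simp add: power_add mult_right_mono)
      also have "\<dots> \<le> 2 * (W n (i - n) * a J (i - n))" using s(3) True by simp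
      also have "\<dots> = W n (i - n) * (2 * a J (i - n))" by simp
      also have "\<dots> \<le> W n (i - n) * (W t (i - n - t) * a J (i - n - t))"
        using W_pos by (intro mult_left_mono t) (auto simp: less_imp_le)
      also have "\<dots> = W (n + t) (i - (n + t)) * a J (i - (n + t))"
      proof -
        have eq: "t + (i - n - t) = i - n" "i - (n + t) = i - n - t" "n + t = t + n"
          using t(2) by auto
        have "W (n + t) (i - (n + t)) = W t (i - n - t) * W n (i - n)"
          using W_add[of t n "i - n - t"] unfolding eq(1,2) unfolding eq(3) .
        then show ?thesis unfolding eq(2) by simp
      qed
      finally show ?thesis
        using t \<open>t \<noteq> 0\<close> by (intro exI[of _ "n + t"]) simp
    qed
  qed
  define C' where "C' = max C 1"
  have C': "0 < C'" "C \<le> C'" by (auto simp: C'_def)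
  obtain u where u: "D * C' < \<beta> ^ u" using real_arch_pow[OF \<beta>] by blast
  \<comment> \<open>The first step, from \<open>m'\<close> to \<open>J\<close>, uses at most
    \<open>N2\<close> of these, so at least \<open>u\<close> remain for the growth that has to beat
    \<open>D * C'\<close>.\<close>
  define n where "n = N2 + u"
  obtain K where K: "\<And>k. k \<ge> K \<Longrightarrow> a q k * a m (n + k) \<le> C * (a J k * a m' (n + k))"
    using C[of n] by blast
  obtain k where k: "k \<ge> max K (K0 + N0 + K2)" "W n k * a J k \<le> 2 * a m (n + k)"
    using R[of n "max K (K0 + N0 + K2)"] N2 by (auto simp: n_def simp del: max.bounded_iff)
  define i where "i = n + k"
  obtain s1 where s1: "s1 \<le> N2" "2 * a m' i \<le> W s1 (i - s1) * a J (i - s1)"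
    using j2[of i] k by (auto simp: i_def)
  define i1 n1 where "i1 = i - s1" and "n1 = n - s1"
  have "K0 + N0 \<le> k" "s1 \<le> n" using k(1) s1(1) by (auto simp: n_def)
  then have "i1 \<ge> n1 + K0 + N0" unfolding i1_def n1_def i_def by arith
  then obtain s where s: "n1 \<le> s" "s \<le> n1 + N0" "\<beta> ^ s * a J i1 \<le> W s (i1 - s) * a J (i1 - s)"
    using chain by blast
  \<comment> \<open>\<open>n1\<close> further steps from \<open>i1\<close> would end exactly at
    \<open>k\<close>; the chain overshoots by \<open>t \<le> N0\<close> and ends at
    \<open>p\<close>. This overshoot is what \<open>q\<close> and \<open>D\<close> absorb.\<close>
  define t p where "t = s - n1" and "p = i1 - s"
  have tp: "t \<le> N0" "t + p = k" "s = t + n1" "n1 + k = i1" "n = n1 + s1" "u \<le> s"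
    using s s1 k by (auto simp: t_def p_def n1_def i1_def i_def n_def)
  have "\<beta> ^ s * a J i1 \<le> W n1 k * (W t p * a J p)"
  proof -
    have "W s p = W t p * W n1 k" using W_add[of t n1 p] unfolding tp(2) tp(3)[symmetric] .
    then show ?thesis using s(3) unfolding p_def[symmetric] by (simp add: ac_simps)
  qed
  also have "\<dots> \<le> W n1 k * (D * a q k)"
    using D(2)[OF tp(1), of p] W_pos by (intro mult_left_mono) (auto simp: tp less_imp_le)
  finally have q: "\<beta> ^ s * a J i1 \<le> W n1 k * (D * a q k)" .
  have "\<beta> ^ s * (2 * a m' i) \<le> \<beta> ^ s * (W s1 i1 * a J i1)"
    using s1 \<beta> by (intro mult_left_mono) (auto simp: i1_def)
  also have "\<dots> = W s1 i1 * (\<beta> ^ s * a J i1)" by simp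
  also have "\<dots> \<le> W s1 i1 * (W n1 k * (D * a q k))"
    using W_pos by (intro mult_left_mono q) (auto simp: less_imp_le)
  also have "\<dots> = D * W n k * a q k"
    using W_add[of n1 s1 k] tp by simp
  \<comment> \<open>The factor \<open>a m i\<close> is inserted so that \<open>H\<close> applies: it
    changes \<open>q\<close> to \<open>J\<close> at \<open>k\<close> while \<open>m\<close> becomes
    \<open>m'\<close> at \<open>i\<close>. Then the choice of \<open>k\<close> through
    \<open>R\<close> bounds \<open>W n k * a J k\<close> by \<open>2 * a m i\<close>, and everything
    cancels except \<open>\<beta> ^ s\<close> against \<open>D * C'\<close>.\<close>
  finally have "2 * \<beta> ^ s * a m' i * a m i \<le> D * W n k * a q k * a m i"
    using a_pos[of m i] by (intro mult_right_mono) auto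
  also have "\<dots> = D * W n k * (a q k * a m (n + k))" by (simp add: i_def)
  also have "\<dots> \<le> D * W n k * (C * (a J k * a m' i))"
    using K[of k] k D W_pos by (intro mult_left_mono) (auto simp: i_def less_imp_le)
  also have "\<dots> \<le> D * W n k * (C' * (a J k * a m' i))"
    using C' D W_pos a_pos by (intro mult_left_mono mult_right_mono) (auto simp: less_imp_le)
  also have "\<dots> = D * C' * (W n k * a J k) * a m' i" by simp
  also have "\<dots> \<le> D * C' * (2 * a m i) * a m' i"
    using D C' k a_pos by (intro mult_left_mono mult_right_mono) (auto simp: i_def less_imp_le)
  finally have "\<beta> ^ s * (2 * a m i * a m' i) \<le> (D * C') * (2 * a m i * a m' i)"
    by (simp add: ac_simps)
  then have "\<beta> ^ s \<le> D * C'"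
    using a_pos[of m i] a_pos[of m' i] by (simp add: mult_le_cancel_right)
  moreover have "\<beta> ^ u \<le> \<beta> ^ s" using \<beta> tp by (intro power_increasing) auto
  ultimately show False using u by simp
qed

text \<open>Multiplying the bound for \<open>J\<close> by the ratio controlled by \<open>H\<close>
  gives bounds for all \<open>j\<close>. Since the constant in \<open>H\<close> is uniform in the
  shift, \<open>q j\<close> and \<open>D j\<close> do not depend on \<open>N\<close>; only the
  thresholds do, and \<open>i\<close> is taken beyond the finitely many of them that matter.\<close>

lemma simultaneous_bounds:
  assumes B: "\<And>n. n \<ge> 1 \<Longrightarrow> \<exists>k. W n k * a J k \<le> C * a m (n + k)"
    and escape: "\<And>K j e N. 0 < e \<Longrightarrow> \<exists>n\<ge>N. \<forall>k<K. a j (n + k) \<le> e * W n k"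
    and H: "\<And>m j. \<exists>m' C. \<forall>n. \<exists>K. \<forall>k\<ge>K. a j k * a m (n + k) \<le> C * (a J k * a m' (n + k))"
  shows "\<exists>q D. \<forall>N K. \<exists>i\<ge>K. \<forall>s\<le>N. \<forall>j\<le>N. s \<le> i \<longrightarrow>
    W s (i - s) * a j (i - s) \<le> D j * a (q j) i"
proof -
  obtain m1 where m1: "\<And>n K. n \<ge> 1 \<Longrightarrow> \<exists>k\<ge>K. W n k * a J k \<le> 2 * a m1 (n + k)"
    using recurrent_bound[OF B escape] by blast
  obtain m2 where m2: "\<And>N K. \<exists>i\<ge>K. \<forall>s\<le>N. s \<le> i \<longrightarrow> W s (i - s) * a J (i - s) \<le> 2 * a m2 i"
    using simultaneous_bound[OF m1 H] by blast
  obtain q D where qD: "\<And>j n. \<exists>K. \<forall>k\<ge>K. a j k * a m2 (n + k) \<le> D j * (a J k * a (q j) (n + k))"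
    using H[of _ m2] by metis
  then obtain \<kappa> where \<kappa>: "\<And>j n k. k \<ge> \<kappa> j n \<Longrightarrow> a j k * a m2 (n + k) \<le> D j * (a J k * a (q j) (n + k))"
    by metis
  have "\<exists>i\<ge>K. \<forall>s\<le>N. \<forall>j\<le>N. s \<le> i \<longrightarrow> W s (i - s) * a j (i - s) \<le> (2 * max (D j) 0) * a (q j) i" for N K
  proof -
    define K' where "K' = Max ((\<lambda>(j, n). \<kappa> j n) ` ({..N} \<times> {..N}))"
    have K': "\<kappa> j s \<le> K'" if "j \<le> N" "s \<le> N" for j s
      unfolding K'_def using that by (intro Max_ge) force+
    obtain i where i: "i \<ge> K + K' + N" "\<And>s. s \<le> N \<Longrightarrow> s \<le> i \<Longrightarrow> W s (i - s) * a J (i - s) \<le> 2 * a m2 i"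
      using m2 by blast
    have "W s (i - s) * a j (i - s) \<le> (2 * max (D j) 0) * a (q j) i" if s: "s \<le> N" and j: "j \<le> N" for s j
    proof -
      have si: "s \<le> i" "i - s \<ge> K'" using i s by auto
      have "(W s (i - s) * a j (i - s)) * a m2 i = W s (i - s) * (a j (i - s) * a m2 (s + (i - s)))"
        using si by simp
      also have "\<dots> \<le> W s (i - s) * (D j * (a J (i - s) * a (q j) (s + (i - s))))"
        using W_pos K'[OF j s] si by (intro mult_left_mono \<kappa>) (auto simp: less_imp_le)
      also have "\<dots> = D j * (W s (i - s) * a J (i - s)) * a (q j) i" using si by simp
      also have "\<dots> \<le> max (D j) 0 * (2 * a m2 i) * a (q j) i"
        using W_pos[of s "i - s"] a_pos[of J "i - s"] a_pos[of "q j" i]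
        by (intro mult_right_mono[OF mult_mono[OF max.cobounded1 i(2)[OF s si(1)]]])
          (auto simp: less_imp_le)
      also have "\<dots> = (2 * max (D j) 0 * a (q j) i) * a m2 i" by simp
      finally show ?thesis using a_pos[of m2 i] by (simp add: mult_le_cancel_right)
    qed
    then show ?thesis using i by (intro exI[of _ i]) auto
  qed
  then show ?thesis by (intro exI[of _ q] exI[of _ "\<lambda>j. 2 * max (D j) 0"]) blast
qed

end

section \<open>Koethe spaces and the shift\<close>

locale koethe_space = solid_space E \<nu> for E \<nu> +
  fixes a :: "nat \<Rightarrow> nat \<Rightarrow> real"
  assumes koethe: "koethe_matrix a"
begin

lemma entry_pos: "0 < a j k" using koethe by (simp add: koethe_matrix_def)

lemma entry_mono: "i \<le> j \<Longrightarrow> a i k \<le> a j k"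
  using koethe lift_Suc_mono_le[of "\<lambda>j. a j k" i j] by (simp add: koethe_matrix_def)

definition wt :: "nat \<Rightarrow> (nat \<Rightarrow> 'b::real_normed_field) \<Rightarrow> nat \<Rightarrow> real" where
  "wt j x = (\<lambda>k. norm (x k) * a j k)"

definition V :: "(nat \<Rightarrow> 'b::real_normed_field) set" where
  "V = {x. \<forall>j. wt j x \<in> E}"

definition P :: "nat \<Rightarrow> (nat \<Rightarrow> 'b::real_normed_field) \<Rightarrow> real" where
  "P j x = \<nu> (wt j x)"

abbreviation X :: "(nat \<Rightarrow> 'b::real_normed_field) topology" where
  "X \<equiv> seminorm_topology V P"

lemma wt_nonneg: "0 \<le> wt j x k" by (simp add: wt_def less_imp_le[OF entry_pos])

lemma wt_mem: "x \<in> V \<Longrightarrow> wt j x \<in> E" by (simp add: V_def)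

lemma P_dominated:
  "f \<in> E \<Longrightarrow> (\<And>k. wt j x k \<le> f k) \<Longrightarrow> wt j x \<in> E \<and> P j x \<le> \<nu> f"
  using solid[of f "wt j x"] wt_nonneg unfolding P_def by blast

lemma P_coord: "x \<in> V \<Longrightarrow> norm (x k) * a j k \<le> P j x"
  using coord_le[OF wt_mem, of x j k] by (simp add: P_def wt_def)

lemma P_nonneg: "x \<in> V \<Longrightarrow> 0 \<le> P j x"
  by (simp add: P_def norm_nonneg wt_mem)

lemma P_mono: "x \<in> V \<Longrightarrow> i \<le> j \<Longrightarrow> P i x \<le> P j x"
  unfolding P_def by (rule conjunct2[OF solid])
    (auto simp: wt_mem wt_nonneg, auto simp: wt_def entry_mono mult_left_mono)

lemma V_add: "x \<in> V \<Longrightarrow> y \<in> V \<Longrightarrow> x + y \<in> V"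
  and P_add: "x \<in> V \<Longrightarrow> y \<in> V \<Longrightarrow> P j (x + y) \<le> P j x + P j y"
proof -
  assume x: "x \<in> V" and y: "y \<in> V"
  have "wt j (x + y) k \<le> wt j x k + wt j y k" for j k
    using norm_triangle_ineq[of "x k" "y k"] entry_pos[of j k]
    by (simp add: wt_def distrib_right[symmetric] mult_right_mono)
  then have "wt j (x + y) \<in> E \<and> P j (x + y) \<le> \<nu> (\<lambda>k. wt j x k + wt j y k)" for j
    using add[OF wt_mem[OF x] wt_mem[OF y]] by (intro P_dominated) auto
  moreover have "\<nu> (\<lambda>k. wt j x k + wt j y k) \<le> P j x + P j y" for j
    using add[OF wt_mem[OF x] wt_mem[OF y]] by (auto simp: P_def)
  ultimately show "x + y \<in> V" "P j (x + y) \<le> P j x + P j y"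
    by (auto simp: V_def intro: order_trans)
qed

lemma wt_scale: "wt j (\<lambda>k. c * x k) = (\<lambda>k. norm c * wt j x k)"
  by (simp add: wt_def norm_mult mult.assoc)

lemma V_scale: "x \<in> V \<Longrightarrow> (\<lambda>k. c * x k) \<in> V"
  and P_scale: "x \<in> V \<Longrightarrow> P j (\<lambda>k. c * x k) = norm c * P j x"
  using scale[OF wt_mem, of x "norm c"] by (auto simp: V_def P_def wt_scale)

lemma V_minus: "x \<in> V \<Longrightarrow> - x \<in> V"
  and P_minus: "P j (- x) = P j x"
  by (auto simp: V_def P_def wt_def)

lemma V_diff: "x \<in> V \<Longrightarrow> y \<in> V \<Longrightarrow> x - y \<in> V"
  and P_diff: "x \<in> V \<Longrightarrow> y \<in> V \<Longrightarrow> P j (x - y) \<le> P j x + P j y"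
  using V_add[of x "- y"] P_add[of x "- y" j] V_minus[of y] P_minus[of j y] by auto

lemma P_diff_commute: "P j (x - y) = P j (y - x)"
  by (simp add: P_def wt_def norm_minus_commute)

lemma V_zero: "(0 :: nat \<Rightarrow> 'b::real_normed_field) \<in> V"
  and P_zero: "P j (0 :: nat \<Rightarrow> 'b) = 0"
proof -
  have "wt j (0 :: nat \<Rightarrow> 'b) = (\<lambda>k. if k = 0 then 0 else 0)" for j by (auto simp: wt_def)
  then show "(0 :: nat \<Rightarrow> 'b) \<in> V" "P j (0 :: nat \<Rightarrow> 'b) = 0" using unit[of 0 0] by (auto simp: V_def P_def)
qed

lemma V_coord_seq: "(\<lambda>k. if k = i then c else 0) \<in> V"
  and P_coord_seq: "P j (\<lambda>k. if k = i then c else 0) = norm c * a j i"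
proof -
  have eq: "wt j (\<lambda>k. if k = i then c else 0) = (\<lambda>k. if k = i then norm c * a j i else 0)" for j
    by (auto simp: wt_def)
  have "0 \<le> norm c * a j i" for j by (simp add: less_imp_le[OF entry_pos])
  then show "(\<lambda>k. if k = i then c else 0) \<in> V" "P j (\<lambda>k. if k = i then c else 0) = norm c * a j i"
    using unit by (auto simp: V_def P_def eq)
qed

lemma unit_seq_mem: "(unit_seq i :: nat \<Rightarrow> 'b::real_normed_field) \<in> V"
  and P_unit_seq: "P j (unit_seq i :: nat \<Rightarrow> 'b) = a j i"
  using V_coord_seq[of i 1] P_coord_seq[of j i "1::'b"] by (auto simp: unit_seq_def)

lemma P_pos: "x \<in> V \<Longrightarrow> x \<noteq> 0 \<Longrightarrow> 0 < P j x"
proof -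
  assume x: "x \<in> V" "x \<noteq> 0"
  then obtain k where "x k \<noteq> 0" by (auto simp: fun_eq_iff)
  then have "0 < norm (x k) * a j k" by (simp add: entry_pos)
  then show ?thesis using P_coord[OF x(1), of k j] by linarith
qed

lemma wt_tail: "wt j (tail n x) = tail n (wt j x)"
  by (auto simp: wt_def tail_def)

lemma V_tail: "x \<in> V \<Longrightarrow> tail n x \<in> V"
  and P_tail_le: "x \<in> V \<Longrightarrow> P j (tail n x) \<le> P j x"
  using tail_mem[OF wt_mem] by (auto simp: V_def P_def wt_tail)

lemma P_tail_small: "x \<in> V \<Longrightarrow> 0 < e \<Longrightarrow> \<exists>n. \<forall>k\<ge>n. P j (tail k x) < e"
  using tail_eventually_small[OF wt_mem] by (simp add: P_def wt_tail)

definition trunc :: "nat \<Rightarrow> (nat \<Rightarrow> 'b::real_normed_field) \<Rightarrow> nat \<Rightarrow> 'b" where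
  "trunc n x = (\<lambda>k. if k < n then x k else 0)"

lemma trunc_eq_diff: "trunc n x = x - tail n x"
  by (auto simp: trunc_def tail_def)

lemma V_trunc: "x \<in> V \<Longrightarrow> trunc n x \<in> V"
  by (simp add: trunc_eq_diff V_diff V_tail)

text \<open>Completeness in the form in which vectors are built later. Coordinates converge
  absolutely because the seminorm with index 0 already dominates them; the bound follows entrywise
  from the triangle inequality and then from \<open>series\<close>.\<close>

lemma V_series:
  fixes F :: "nat \<Rightarrow> nat \<Rightarrow> 'b::{real_normed_field,banach}"
  assumes F: "\<And>i. F i \<in> V" and s: "\<And>j. summable (\<lambda>i. P j (F i))"
  shows "summable (\<lambda>i. F i k)" and "(\<lambda>k. \<Sum>i. F i k) \<in> V"
    and "P j (\<lambda>k. \<Sum>i. F i k) \<le> (\<Sum>i. P j (F i))"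
proof -
  have sn: "summable (\<lambda>i. norm (F i k))" for k
  proof (rule summable_comparison_test')
    show "summable (\<lambda>i. P 0 (F i) / a 0 k)" using s by (rule summable_divide)
    show "norm (norm (F i k)) \<le> P 0 (F i) / a 0 k" for i
      using P_coord[OF F, of i k 0] entry_pos[of 0 k] by (simp add: field_simps)
  qed
  then show "summable (\<lambda>i. F i k)" by (rule summable_norm_cancel)
  have "wt j (\<lambda>k. \<Sum>i. F i k) k \<le> (\<Sum>i. wt j (F i) k)" for j k
    using summable_norm[OF sn[of k]] entry_pos[of j k]
    by (simp add: wt_def suminf_mult2[OF sn, symmetric] mult_right_mono)
  then have "wt j (\<lambda>k. \<Sum>i. F i k) \<in> E \<and> P j (\<lambda>k. \<Sum>i. F i k) \<le> \<nu> (\<lambda>k. \<Sum>i. wt j (F i) k)" for j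
    using series[of "\<lambda>i. wt j (F i)"] s[of j] F by (intro P_dominated) (auto simp: P_def wt_mem)
  moreover have "\<nu> (\<lambda>k. \<Sum>i. wt j (F i) k) \<le> (\<Sum>i. P j (F i))" for j
    using series[of "\<lambda>i. wt j (F i)"] s[of j] F by (auto simp: P_def wt_mem)
  ultimately show "(\<lambda>k. \<Sum>i. F i k) \<in> V" "P j (\<lambda>k. \<Sum>i. F i k) \<le> (\<Sum>i. P j (F i))"
    by (auto simp: V_def intro: order_trans)
qed

section \<open>Topology and dense orbits in Koethe spaces\<close>

lemma openin_ball:
  assumes "x \<in> V"
  shows "openin X {y \<in> V. P j (y - x) < e}"
proof (cases "e > 0")
  case True
  then show ?thesis
    unfolding seminorm_topology_def using assms by (intro topology_generated_by_Basis) blast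
next
  case False
  then have empty: "{y \<in> V. P j (y - x) < e} = {}"
    using P_nonneg[OF V_diff[OF _ assms]] by (auto simp: not_less intro: order_trans)
  show ?thesis unfolding empty by (rule openin_empty)
qed

text \<open>The seminorms increase with the index, so an intersection of two balls about a point
  contains a ball of a single seminorm, namely the one with the larger index.\<close>

lemma openin_koethe_iff:
  "openin X U \<longleftrightarrow> U \<subseteq> V \<and> (\<forall>x\<in>U. \<exists>j. \<exists>e>0. \<forall>y\<in>V. P j (y - x) < e \<longrightarrow> y \<in> U)"
  (is "_ \<longleftrightarrow> _ \<and> ?nbhd U")
proof
  assume U: "openin X U"
  then show "U \<subseteq> V \<and> ?nbhd U"
    unfolding seminorm_topology_def openin_topology_generated_by_iff
  proof (induction rule: generate_topology_on.induct)
    case (Int U1 U2)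
    have "?nbhd (U1 \<inter> U2)"
    proof
      fix x assume "x \<in> U1 \<inter> U2"
      then obtain j1 e1 j2 e2 where
        1: "e1 > 0" "\<And>y. y \<in> V \<Longrightarrow> P j1 (y - x) < e1 \<Longrightarrow> y \<in> U1" and
        2: "e2 > 0" "\<And>y. y \<in> V \<Longrightarrow> P j2 (y - x) < e2 \<Longrightarrow> y \<in> U2"
        using Int.IH by blast
      have xV: "x \<in> V"
        using Int.IH \<open>x \<in> U1 \<inter> U2\<close> by blast
      have "y \<in> U1 \<inter> U2" if "y \<in> V" "P (max j1 j2) (y - x) < min e1 e2" for y
        using that 1 2 P_mono[OF V_diff[OF that(1) xV], of j1 "max j1 j2"]
          P_mono[OF V_diff[OF that(1) xV], of j2 "max j1 j2"] by auto
      then show "\<exists>j. \<exists>e>0. \<forall>y\<in>V. P j (y - x) < e \<longrightarrow> y \<in> U1 \<inter> U2"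
        using 1 2 by (intro exI[of _ "max j1 j2"] exI[of _ "min e1 e2"]) auto
    qed
    then show ?case using Int.IH by blast
  next
    case (UN K)
    then show ?case by (meson Union_iff Union_least)
  next
    case (Basis s)
    then obtain j z e where s: "s = {y \<in> V. P j (y - z) < e}" "z \<in> V" by blast
    have "?nbhd s"
    proof
      fix x assume x: "x \<in> s"
      have "y \<in> s" if y: "y \<in> V" "P j (y - x) < e - P j (x - z)" for y
      proof -
        have "y - z = (y - x) + (x - z)" by simp
        then have "P j (y - z) \<le> P j (y - x) + P j (x - z)"
          using P_add[of "y - x" "x - z" j] V_diff x y s by force
        then show ?thesis using y s by simp
      qed
      then show "\<exists>j. \<exists>e>0. \<forall>y\<in>V. P j (y - x) < e \<longrightarrow> y \<in> s"
        using x s by (intro exI[of _ j] exI[of _ "e - P j (x - z)"]) auto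
    qed
    then show ?case using s by blast
  qed simp
next
  assume U: "U \<subseteq> V \<and> ?nbhd U"
  have "\<exists>T. openin X T \<and> x \<in> T \<and> T \<subseteq> U" if xU: "x \<in> U" for x
  proof -
    obtain j e where e: "e > 0" "\<forall>y\<in>V. P j (y - x) < e \<longrightarrow> y \<in> U"
      using U xU by blast
    have x: "x \<in> V" using U xU by blast
    show ?thesis
    proof (intro exI conjI)
      show "openin X {y \<in> V. P j (y - x) < e}" by (rule openin_ball[OF x])
      show "x \<in> {y \<in> V. P j (y - x) < e}" using x e(1) by (simp add: P_zero)
      show "{y \<in> V. P j (y - x) < e} \<subseteq> U" using e(2) by blast
    qed
  qed
  then show "openin X U" using openin_subopen by blast
qed

lemma hypercyclic_vector_iff:
  fixes x :: "nat \<Rightarrow> 'b::real_normed_field"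
  shows "hypercyclic_vector X T x \<longleftrightarrow>
    x \<in> V \<and> (\<forall>y\<in>V. \<forall>j. \<forall>e>0. \<exists>n\<ge>1. (T ^^ n) x \<in> V \<and> P j ((T ^^ n) x - y) < e)"
proof -
  have "X closure_of {(T ^^ n) x |n. n \<ge> 1} = V \<longleftrightarrow>
      (\<forall>y\<in>V. \<forall>j. \<forall>e>0. \<exists>n\<ge>1. (T ^^ n) x \<in> V \<and> P j ((T ^^ n) x - y) < e)" (is "?cl = V \<longleftrightarrow> ?R")
  proof
    assume cl: "?cl = V"
    show ?R
    proof (intro ballI allI impI)
      fix y :: "nat \<Rightarrow> 'b" and j and e :: real assume y: "y \<in> V" and e: "e > 0"
      have "y \<in> {z \<in> V. P j (z - y) < e}" using y e by (simp add: P_zero)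
      moreover have "y \<in> ?cl" using cl y by simp
      ultimately obtain z where "z \<in> {(T ^^ n) x |n. n \<ge> 1}" "z \<in> {z \<in> V. P j (z - y) < e}"
        using openin_ball[OF y, of j e] unfolding in_closure_of by meson
      then show "\<exists>n\<ge>1. (T ^^ n) x \<in> V \<and> P j ((T ^^ n) x - y) < e" by auto
    qed
  next
    assume R: ?R
    have "y \<in> ?cl" if y: "y \<in> V" for y
      unfolding in_closure_of topspace_seminorm_topology
    proof (intro conjI allI impI y)
      fix U assume U: "y \<in> U \<and> openin X U"
      then obtain j e where "e > 0" "\<forall>z\<in>V. P j (z - y) < e \<longrightarrow> z \<in> U"
        unfolding openin_koethe_iff by blast
      then show "\<exists>z. z \<in> {(T ^^ n) x |n. n \<ge> 1} \<and> z \<in> U" using R y by blast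
    qed
    then show "?cl = V"
      using closure_of_subset_topspace[of X] by (auto simp: topspace_seminorm_topology)
  qed
  then show ?thesis by (simp add: hypercyclic_vector_def topspace_seminorm_topology)
qed

text \<open>Perturbing the target avoids the finitely many iterates below \<open>N\<close>.\<close>

lemma hypercyclic_vector_late:
  fixes x y :: "nat \<Rightarrow> 'b::real_normed_field"
  assumes x: "hypercyclic_vector X T x" and y: "y \<in> V" and e: "0 < e"
  shows "\<exists>n\<ge>N. n \<ge> 1 \<and> (T ^^ n) x \<in> V \<and> P j ((T ^^ n) x - y) < e"
proof -
  \<comment> \<open>Looking at coordinate 0 suffices: a small \<open>t\<close> outside this finite
    set makes the perturbed target \<open>y + u\<close> differ there from each early iterate, and
    \<open>\<delta>\<close> is below all these differences.\<close>
  define bad where "bad = (\<lambda>n. ((T ^^ n) x - y) 0) ` {..<N}"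
  define r where "r = e / (2 * a j 0)"
  have r: "r > 0" using e entry_pos by (simp add: r_def)
  have "infinite (of_real ` {0<..<r} :: 'b set)"
    using r by (subst finite_image_iff) (auto simp: inj_on_def infinite_Ioo)
  then obtain t where t: "0 < t" "t < r" "(of_real t :: 'b) \<notin> bad"
    using finite_subset[of "of_real ` {0<..<r}" bad] by (force simp: bad_def)
  define u where "u = (\<lambda>k::nat. if k = 0 then of_real t else 0 :: 'b)"
  have u: "u \<in> V" "P j u \<le> e / 2"
    using V_coord_seq[of 0 "of_real t :: 'b"] P_coord_seq[of j 0 "of_real t :: 'b"] t entry_pos[of j 0]
    by (auto simp: u_def r_def field_simps)
  define \<delta> where "\<delta> = Min (insert (e / 2) ((\<lambda>b. norm (b - of_real t) * a j 0) ` bad))"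
  have fin: "finite bad" by (simp add: bad_def)
  have "0 < norm (b - of_real t) * a j 0" if "b \<in> bad" for b
    using that t(3) entry_pos[of j 0] by (cases "b = of_real t") auto
  then have \<delta>: "0 < \<delta>" using fin e by (auto simp: \<delta>_def)
  obtain n where n: "n \<ge> 1" "(T ^^ n) x \<in> V" "P j ((T ^^ n) x - (y + u)) < \<delta>"
    using x \<delta> V_add[OF y u(1)] unfolding hypercyclic_vector_iff by blast
  have "n \<ge> N"
  proof (rule ccontr)
    assume "\<not> n \<ge> N"
    then have b: "((T ^^ n) x - y) 0 \<in> bad" by (auto simp: bad_def)
    have "\<delta> \<le> norm (((T ^^ n) x - y) 0 - of_real t) * a j 0"
      unfolding \<delta>_def using fin b by (intro Min_le) auto
    also have "\<dots> = norm (((T ^^ n) x - (y + u)) 0) * a j 0" by (simp add: u_def diff_diff_eq)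
    also have "\<dots> \<le> P j ((T ^^ n) x - (y + u))"
      using n u y by (intro P_coord V_diff V_add)
    finally show False using n by simp
  qed
  moreover have "P j ((T ^^ n) x - y) < e"
  proof -
    have "(T ^^ n) x - y = ((T ^^ n) x - (y + u)) + u" by simp
    then have "P j ((T ^^ n) x - y) \<le> P j ((T ^^ n) x - (y + u)) + P j u"
      using P_add[of "(T ^^ n) x - (y + u)" u j] n u y V_diff V_add by metis
    moreover have "\<delta> \<le> e / 2" unfolding \<delta>_def using fin by (intro Min_le) auto
    ultimately show ?thesis using n u by linarith
  qed
  ultimately show ?thesis using n by blast
qed

end

section \<open>The shift operator and its iterates\<close>

locale koethe_shift = koethe_space E \<nu> a for E \<nu> a +
  fixes w :: "nat \<Rightarrow> 'a::{real_normed_field,banach}" and B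
  assumes shift_op: "weighted_shift (X :: (nat \<Rightarrow> 'a) topology) w B"
begin

lemma weight_nonzero: "w n \<noteq> 0"
  and B_unit_0: "B (unit_seq 0) = 0"
  and B_unit_Suc: "B (unit_seq (Suc n)) = (\<lambda>k. w (Suc n) * unit_seq n k)"
  and B_add: "x \<in> V \<Longrightarrow> y \<in> V \<Longrightarrow> B (x + y) = B x + B y"
  and B_scale: "x \<in> V \<Longrightarrow> B (\<lambda>k. c * x k) = (\<lambda>k. c * B x k)"
  and B_cont: "continuous_map X X B"
  using shift_op by (auto simp: weighted_shift_def topspace_seminorm_topology)

lemma B_mem: "x \<in> V \<Longrightarrow> B x \<in> V"
  using continuous_map_image_subset_topspace[OF B_cont] by (auto simp: topspace_seminorm_topology)

lemma B_zero: "B 0 = 0"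
  using B_scale[OF unit_seq_mem, of 0 0] by (simp add: zero_fun_def)

lemma B_bounded: "\<exists>q D. \<forall>x\<in>V. P j (B x) \<le> D * P q x"
proof -
  have "openin X {x \<in> topspace X. B x \<in> {y \<in> V. P j (y - 0) < 1}}"
    using openin_continuous_map_preimage[OF B_cont openin_ball[OF V_zero]] .
  then have nbhd: "\<forall>x\<in>{x \<in> topspace X. B x \<in> {y \<in> V. P j (y - 0) < 1}}.
      \<exists>q. \<exists>e>0. \<forall>y\<in>V. P q (y - x) < e \<longrightarrow> y \<in> {x \<in> topspace X. B x \<in> {y \<in> V. P j (y - 0) < 1}}"
    unfolding openin_koethe_iff by (rule conjunct2)
  have "0 \<in> {x \<in> topspace X. B x \<in> {y \<in> V. P j (y - 0) < 1}}"
    using V_zero P_zero[where ?'b = 'a] by (simp add: topspace_seminorm_topology B_zero)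
  from bspec[OF nbhd this] obtain q e
    where e: "e > 0" "\<And>y. y \<in> V \<Longrightarrow> P q y < e \<Longrightarrow> P j (B y) < 1"
    by (auto simp: diff_zero)
  have "P j (B x) \<le> (2 / e) * P q x" if x: "x \<in> V" for x
  proof (cases "x = 0")
    case True
    then show ?thesis using P_zero[where ?'b = 'a] by (simp add: B_zero)
  next
    case False
    then have pos: "P q x > 0" using P_pos x by blast
    define c :: 'a where "c = of_real (e / (2 * P q x))"
    have nc: "norm c = e / (2 * P q x)" using e pos unfolding c_def norm_of_real by simp
    have "P q (\<lambda>k. c * x k) < e" using P_scale[OF x, of q c] e pos by (simp add: nc)
    then have "P j (B (\<lambda>k. c * x k)) < 1" using e V_scale[OF x] by blast
    then have "norm c * P j (B x) < 1"
      using P_scale[OF B_mem[OF x], of j c] by (simp add: B_scale x)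
    then show ?thesis using pos e by (simp add: nc field_simps)
  qed
  then show ?thesis by blast
qed

lemma B_trunc: "x \<in> V \<Longrightarrow> B (trunc n x) k = w (Suc k) * trunc n x (Suc k)"
proof (induction n)
  case 0
  have eq: "trunc 0 x = 0" by (auto simp: trunc_def)
  show ?case unfolding eq B_zero by simp
next
  case (Suc n)
  have eq: "trunc (Suc n) x = trunc n x + (\<lambda>k. x n * unit_seq n k)"
    by (auto simp: trunc_def unit_seq_def less_Suc_eq)
  have "B (trunc (Suc n) x) k = B (trunc n x) k + x n * B (unit_seq n) k"
    unfolding eq using Suc.prems by (simp add: B_add B_scale V_trunc V_scale unit_seq_mem)
  also have "B (unit_seq n) k = w (Suc k) * unit_seq n (Suc k)"
    by (cases n) (simp_all add: B_unit_0 B_unit_Suc, simp_all add: unit_seq_def)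
  finally show ?case using Suc by (simp add: eq algebra_simps)
qed

text \<open>The shift is prescribed on unit sequences only. Linearity extends the formula to
  truncations, and continuity makes the contribution of \<open>tail m x\<close> arbitrarily
  small.\<close>

lemma B_coord:
  assumes x: "x \<in> V"
  shows "B x k = w (Suc k) * x (Suc k)"
proof -
  obtain q D where D: "\<And>y. y \<in> V \<Longrightarrow> P 0 (B y) \<le> D * P q y" using B_bounded by blast
  define C where "C = max D 1"
  have C: "C > 0" "D \<le> C" by (auto simp: C_def)
  have "norm (B x k - w (Suc k) * x (Suc k)) * a 0 k \<le> e" if e: "e > 0" for e
  proof -
    obtain n where n: "\<And>m. m \<ge> n \<Longrightarrow> P q (tail m x) < e / C"
      using P_tail_small[OF x, of "e / C" q] e C by auto
    define m where "m = max n (k + 2)"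
    have "x = trunc m x + tail m x" by (simp add: trunc_eq_diff)
    then have "B x = B (trunc m x) + B (tail m x)"
      using B_add[OF V_trunc[OF x] V_tail[OF x]] by metis
    then have "B x k - w (Suc k) * x (Suc k) = B (tail m x) k"
      by (simp add: B_trunc[OF x]) (simp add: trunc_def m_def)
    then have "norm (B x k - w (Suc k) * x (Suc k)) * a 0 k \<le> P 0 (B (tail m x))"
      using P_coord[OF B_mem[OF V_tail[OF x]], of m k 0] by simp
    also have "\<dots> \<le> D * P q (tail m x)" by (rule D[OF V_tail[OF x]])
    also have "\<dots> \<le> C * P q (tail m x)"
      using C P_nonneg[OF V_tail[OF x]] by (intro mult_right_mono)
    also have "\<dots> \<le> e" using n[of m] C by (simp add: m_def field_simps)
    finally show ?thesis .
  qed
  then have "norm (B x k - w (Suc k) * x (Suc k)) * a 0 k \<le> 0"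
    using field_le_epsilon[of "norm (B x k - w (Suc k) * x (Suc k)) * a 0 k" 0] by auto
  then have "norm (B x k - w (Suc k) * x (Suc k)) \<le> 0"
    using entry_pos[of 0 k] by (simp add: mult_le_0_iff)
  then show ?thesis by simp
qed

sublocale weight_matrix a "\<lambda>k. norm (w k)"
proof
  show "koethe_matrix a" by (rule koethe)
  show "0 < norm (w k)" for k using weight_nonzero by simp
  show "\<exists>q D. \<forall>k. norm (w (Suc k)) * a j k \<le> D * a q (Suc k)" for j
  proof -
    obtain q D where D: "\<And>y. y \<in> V \<Longrightarrow> P j (B y) \<le> D * P q y" using B_bounded by blast
    have "norm (w (Suc k)) * a j k \<le> D * a q (Suc k)" for k
      using D[OF unit_seq_mem, of "Suc k"] P_scale[OF unit_seq_mem, of j "w (Suc k)" k]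
      by (simp add: B_unit_Suc P_unit_seq)
    then show ?thesis by blast
  qed
qed

definition \<omega> :: "nat \<Rightarrow> nat \<Rightarrow> 'a" where
  "\<omega> n k = (\<Prod>\<mu>=1..n. w (\<mu> + k))"

lemma norm_\<omega>: "norm (\<omega> n k) = W n k"
  by (simp add: \<omega>_def W_def prod_norm)

lemma \<omega>_nonzero: "\<omega> n k \<noteq> 0"
  using W_pos[of n k] norm_\<omega>[of n k] by auto

lemma \<omega>_Suc: "\<omega> (Suc n) k = w (Suc k) * \<omega> n (Suc k)"
proof -
  have "(\<Prod>\<mu>=1..Suc n. w (\<mu> + k)) = w (Suc k) * (\<Prod>\<mu>=Suc 1..Suc n. w (\<mu> + k))"
    by (subst prod.atLeast_Suc_atMost) auto
  also have "(\<Prod>\<mu>=Suc 1..Suc n. w (\<mu> + k)) = (\<Prod>\<mu>=1..n. w (\<mu> + Suc k))"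
    by (subst prod.shift_bounds_cl_Suc_ivl) simp
  finally show ?thesis by (simp add: \<omega>_def)
qed

lemma iter_mem: "x \<in> V \<Longrightarrow> (B ^^ n) x \<in> V"
  by (induction n) (auto intro: B_mem)

lemma iter_coord: "x \<in> V \<Longrightarrow> (B ^^ n) x k = \<omega> n k * x (k + n)"
proof (induction n arbitrary: k)
  case 0
  then show ?case by (simp add: \<omega>_def)
next
  case (Suc n)
  then show ?case by (simp add: B_coord iter_mem \<omega>_Suc)
qed

lemma wt_iter: "x \<in> V \<Longrightarrow> wt j ((B ^^ n) x) k = W n k * a j k * norm (x (k + n))"
  by (simp add: wt_def iter_coord norm_mult norm_\<omega>)

text \<open>Solidity lifts an estimate on unit vectors to \<open>x\<close>. Requiring it only on the
  support of \<open>x\<close> is the point: later the estimate is available only at the selected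
  positions \<open>I m\<close>.\<close>

lemma iter_upper:
  assumes x: "x \<in> V" and D: "0 \<le> D"
    and le: "\<And>k. x (k + n) \<noteq> 0 \<Longrightarrow> W n k * a j k \<le> D * a q (n + k)"
  shows "P j ((B ^^ n) x) \<le> D * P q (tail n x)"
proof -
  have "wt j ((B ^^ n) x) k \<le> D * wt q x (k + n)" for k
  proof (cases "x (k + n) = 0")
    case False
    then show ?thesis
      using mult_right_mono[OF le[OF False], of "norm (x (k + n))"]
      by (simp add: wt_iter[OF x]) (simp add: wt_def ac_simps)
  qed (simp add: wt_iter[OF x] wt_nonneg D)
  then have "P j ((B ^^ n) x) \<le> \<nu> (\<lambda>k. D * wt q x (k + n))"
    using scale[OF conjunct1[OF shift[OF wt_mem[OF x]]] D] P_dominated by blast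
  then show ?thesis
    using scale[OF conjunct1[OF shift[OF wt_mem[OF x]]] D, of q n] shift[OF wt_mem[OF x], of q n]
    by (simp add: P_def wt_tail)
qed

lemma iter_lower:
  assumes x: "x \<in> V" and D: "0 \<le> D"
    and le: "\<And>k. D * a q (n + k) \<le> W n k * a j k"
  shows "D * P q (tail n x) \<le> P j ((B ^^ n) x)"
proof -
  have "D * wt q x (k + n) \<le> wt j ((B ^^ n) x) k" for k
    using mult_right_mono[OF le, of "norm (x (k + n))" k]
    by (simp add: wt_iter[OF x]) (simp add: wt_def ac_simps)
  then have "\<nu> (\<lambda>k. D * wt q x (k + n)) \<le> P j ((B ^^ n) x)"
    unfolding P_def
    by (intro conjunct2[OF solid[OF wt_mem[OF iter_mem[OF x]]]]) (simp_all add: D wt_nonneg)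
  then show ?thesis
    using scale[OF conjunct1[OF shift[OF wt_mem[OF x]]] D, of q n] shift[OF wt_mem[OF x], of q n]
    by (simp add: P_def wt_tail)
qed

text \<open>At a late time the orbit of \<open>x\<close> is close to the vector with
  \<open>K\<close> ones followed by zeros. Then \<open>W n k * norm (x (k + n))\<close> is at least
  1/2 for \<open>k < K\<close>, while the tail of \<open>x\<close> forces
  \<open>norm (x (k + n)) * a j (n + k)\<close> below \<open>e / 2\<close>; dividing gives the
  claim.\<close>

lemma escape_of_hypercyclic:
  assumes h: "hypercyclic_vector X B x" and e: "0 < e"
  shows "\<exists>n\<ge>N. \<forall>k<K. a j (n + k) \<le> e * W n k"
proof -
  have x: "x \<in> V" using h by (simp add: hypercyclic_vector_iff)
  obtain M where M: "\<And>m. m \<ge> M \<Longrightarrow> P j (tail m x) < e / 2"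
    using P_tail_small[OF x, of "e / 2" j] e by auto
  define \<delta> where "\<delta> = Min (insert 1 (a 0 ` {..<K})) / 2"
  have \<delta>: "\<delta> > 0" "\<And>k. k < K \<Longrightarrow> 2 * \<delta> \<le> a 0 k"
    using entry_pos by (auto simp: \<delta>_def)
  define y where "y = (\<lambda>k. if k < K then 1 else 0 :: 'a)"
  have y: "y \<in> V"
  proof -
    have "(\<lambda>k. if k < K then 1 else 0 :: 'a) \<in> V"
    proof (induction K)
      case (Suc K)
      have "(\<lambda>k. if k < Suc K then 1 else 0 :: 'a) = (\<lambda>k. if k < K then 1 else 0) + unit_seq K"
        by (auto simp: unit_seq_def less_Suc_eq)
      then show ?case using Suc V_add unit_seq_mem by metis
    qed (use V_zero in \<open>simp add: zero_fun_def\<close>)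
    then show ?thesis by (simp add: y_def)
  qed
  obtain n where n: "n \<ge> max N M" "P 0 ((B ^^ n) x - y) < \<delta>"
    using hypercyclic_vector_late[OF h y \<delta>(1)] by blast
  have "a j (n + k) \<le> e * W n k" if k: "k < K" for k
  proof -
    have "norm (\<omega> n k * x (k + n) - 1) * a 0 k < \<delta>"
      using P_coord[OF V_diff[OF iter_mem[OF x] y], of n k 0] n k
      by (simp add: iter_coord[OF x] y_def)
    then have "norm (\<omega> n k * x (k + n) - 1) * (2 * \<delta>) < \<delta>"
      using \<delta>(2)[OF k] by (meson le_less_trans mult_left_mono norm_ge_zero)
    then have "norm (\<omega> n k * x (k + n) - 1) < 1 / 2" using \<delta>(1) by simp
    then have "1 / 2 < norm (\<omega> n k * x (k + n))"
      using norm_triangle_ineq2[of 1 "\<omega> n k * x (k + n)"] by (simp add: norm_minus_commute)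
    then have 1: "1 / 2 \<le> W n k * norm (x (k + n))" by (simp add: norm_mult norm_\<omega>)
    have 2: "norm (x (k + n)) * a j (n + k) \<le> e / 2"
      using P_coord[OF V_tail[OF x], of n "k + n" j] M[of n] n by (simp add: tail_def ac_simps)
    have "a j (n + k) * (1 / 2) \<le> a j (n + k) * (W n k * norm (x (k + n)))"
      using 1 entry_pos[of j "n + k"] by (intro mult_left_mono) auto
    also have "\<dots> = W n k * (norm (x (k + n)) * a j (n + k))" by simp
    also have "\<dots> \<le> W n k * (e / 2)" using 2 W_pos by (intro mult_left_mono) (auto simp: less_imp_le)
    finally show ?thesis by (simp add: mult.commute)
  qed
  then show ?thesis using n by (intro exI[of _ n]) auto
qed

end

section \<open>Absence of hypercyclic subspaces\<close>

text \<open>Imposing one more vanishing coordinate lowers the dimension by at most one: a spanning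
  set after the condition, enlarged by one vector violating it, spans the space before it.\<close>

lemma not_finitely_spanned_meets_finite_codim:
  fixes M :: "(nat \<Rightarrow> 'b::field) set"
  assumes M: "seq_subspace M" "\<nexists>S. finite S \<and> seq_span S = M"
  shows "\<exists>z\<in>M. z \<noteq> 0 \<and> (\<forall>k<N. z k = 0)"
proof -
  define R where "R = (\<lambda>n. {x \<in> M. \<forall>k<n. x k = 0})"
  have sub: "seq_subspace (R n)" for n
    using M(1) unfolding R_def seqs.subspace_def by (auto simp: zero_fun_def)
  have inf: "\<nexists>S. finite S \<and> seq_span S = R n" for n
  proof (induction n)
    case 0
    then show ?case using M(2) by (simp add: R_def)
  next
    case (Suc n)
    show ?case
    proof
      assume "\<exists>S. finite S \<and> seq_span S = R (Suc n)"
      then obtain S where S: "finite S" "seq_span S = R (Suc n)" by blast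
      have R_Suc: "R (Suc n) = {x \<in> R n. x n = 0}" by (auto simp: R_def less_Suc_eq)
      have "R (Suc n) \<noteq> R n" using S Suc by auto
      then obtain v where v: "v \<in> R n" "v n \<noteq> 0" by (auto simp: R_Suc)
      have "seq_span (insert v S) = R n"
      proof
        have "S \<subseteq> R n" using S(2) seqs.span_superset[of S] by (auto simp: R_Suc)
        then show "seq_span (insert v S) \<subseteq> R n" using v sub by (intro seqs.span_minimal) auto
        show "R n \<subseteq> seq_span (insert v S)"
        proof
          fix x assume x: "x \<in> R n"
          let ?y = "x - (\<lambda>k. (x n / v n) * v k)"
          have "?y \<in> R n" using x v sub[of n] by (intro seqs.subspace_diff seqs.subspace_scale)
          then have "?y \<in> seq_span S" using v S(2) by (simp add: R_Suc)
          then show "x \<in> seq_span (insert v S)" unfolding seqs.span_breakdown_eq by blast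
        qed
      qed
      then show False using Suc S by blast
    qed
  qed
  have "R N \<noteq> {0}" using inf[of N] seqs.span_empty by (metis finite.emptyI)
  moreover have "0 \<in> R N" using sub[of N] seqs.subspace_0 by blast
  ultimately show ?thesis by (auto simp: R_def)
qed

context koethe_shift
begin

lemma subspace_normalized_tail:
  fixes M :: "(nat \<Rightarrow> 'a) set"
  assumes M: "seq_subspace M" "\<nexists>S. finite S \<and> seq_span S = M" "M \<subseteq> V" and c: "0 < c"
  shows "\<exists>z\<in>M. (\<forall>k<N. z k = 0) \<and> P i z = c"
proof -
  obtain z where z: "z \<in> M" "z \<noteq> 0" "\<forall>k<N. z k = 0"
    using not_finitely_spanned_meets_finite_codim[OF M(1,2)] by blast
  then have pos: "0 < P i z" using P_pos M(3) by blast
  let ?c = "of_real (c / P i z) :: 'a"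
  have "(\<lambda>k. ?c * z k) \<in> M" using M(1) z(1) by (rule seqs.subspace_scale)
  moreover have "P i (\<lambda>k. ?c * z k) = c"
    using P_scale[of z i ?c] z M(3) c pos unfolding norm_of_real by auto
  ultimately show ?thesis using z(3) by (intro bexI[of _ "\<lambda>k. ?c * z k"]) auto
qed

text \<open>The vector \<open>x\<close> is a gliding hump: \<open>s (Suc i) - s i\<close> vanishes up to beyond \<open>N (Suc i)\<close>
  and dominates what lies to its right and to its left there, so it keeps \<open>P J ((B ^^ n) x)\<close>
  large for all \<open>n\<close> between \<open>N i\<close> and \<open>N (Suc i)\<close>.\<close>

lemma no_hypercyclic_subspace:
  assumes growth: "\<And>m C. 0 < C \<Longrightarrow> \<exists>N. \<forall>n\<ge>N. \<forall>k. C * a m (n + k) \<le> W n k * a J k"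
  shows "\<not> hypercyclic_subspace X B M"
proof
  assume hs: "hypercyclic_subspace X B M"
  then have M: "seq_subspace M" "\<nexists>S. finite S \<and> seq_span S = M" "closedin X M"
    and hyp: "\<And>x. x \<in> M \<Longrightarrow> x \<noteq> 0 \<Longrightarrow> hypercyclic_vector X B x"
    by (auto simp: hypercyclic_subspace_def)
  have MV: "M \<subseteq> V" using closedin_subset[OF M(3)] by (simp add: topspace_seminorm_topology)
  \<comment> \<open>The factor \<open>4 ^ i\<close> compensates the size \<open>(1/4) ^ i\<close> of
    the i-th hump. Of the hump the fraction 1 - 1/4 - 1/3 = 5/12 survives its neighbours, and 6
    times 5/12 exceeds 1.\<close>
  have "\<forall>i. \<exists>N. \<forall>n\<ge>N. \<forall>k. (6 * 4 ^ i) * a i (n + k) \<le> W n k * a J k"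
    using growth by simp
  then obtain N0 where N0: "\<And>i n k. n \<ge> N0 i \<Longrightarrow> (6 * 4 ^ i) * a i (n + k) \<le> W n k * a J k"
    by metis
  \<comment> \<open>Partial sums make the thresholds increase, and the summand \<open>i\<close>
    makes them unbounded, so that the intervals from \<open>N i\<close> to \<open>N (Suc i)\<close>
    cover all \<open>n \<ge> N 0\<close>.\<close>
  define N where "N = (\<lambda>i. i + (\<Sum>l\<le>i. N0 l))"
  have N_ge: "N0 i \<le> N i" "i \<le> N i" for i
    using member_le_sum[of i "{..i}" N0] by (auto simp: N_def)
  define step where "step = (\<lambda>n (s :: nat \<Rightarrow> 'a) s'. \<exists>q\<ge>N (Suc n). (\<forall>k<q. (s' - s) k = 0)
    \<and> P n (s' - s) = (1/4) ^ n \<and> P n (tail q s) \<le> (1/4) ^ n / 4)"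
  have "\<exists>s. \<forall>n. (s n \<in> M \<and> (n = 0 \<longrightarrow> s n = 0)) \<and> step n (s n) (s (Suc n))"
  proof (rule dependent_nat_choice)
    show "\<exists>s. s \<in> M \<and> (0 = (0::nat) \<longrightarrow> s = 0)" using seqs.subspace_0[OF M(1)] by blast
    fix s and n :: nat assume s: "s \<in> M \<and> (n = 0 \<longrightarrow> s = 0)"
    then have sV: "s \<in> V" using MV by blast
    obtain q0 where q0: "\<And>q. q \<ge> q0 \<Longrightarrow> P n (tail q s) < (1/4) ^ n / 4"
      using P_tail_small[OF sV, of "(1/4) ^ n / 4" n] by auto
    define q where "q = max q0 (N (Suc n))"
    obtain z where z: "z \<in> M" "\<forall>k<q. z k = 0" "P n z = (1/4) ^ n"
      using subspace_normalized_tail[OF M(1,2) MV, of "(1/4) ^ n" q n] by auto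
    have "step n s (s + z)"
      unfolding step_def using z(2,3) q0[of q] by (intro exI[of _ q]) (auto simp: q_def)
    then show "\<exists>s'. (s' \<in> M \<and> (Suc n = 0 \<longrightarrow> s' = 0)) \<and> step n s s'"
      using seqs.subspace_add[OF M(1)] s z(1) by blast
  qed
  then obtain s where sM: "\<And>n. s n \<in> M" and s0: "s 0 = 0" and step: "\<And>n. step n (s n) (s (Suc n))"
    by blast
  define z where "z = (\<lambda>n. s (Suc n) - s n)"
  have sV: "s n \<in> V" for n using sM MV by blast
  have zV: "z n \<in> V" for n unfolding z_def by (intro V_diff sV)
  have Pz: "P n (z n) = (1/4) ^ n" for n using step[of n] by (auto simp: step_def z_def)
  have Pz_le: "P j (z n) \<le> (1/4) ^ n" if "j \<le> n" for j n
    using P_mono[OF zV[of n] that] Pz[of n] by simp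
  have geo: "summable (\<lambda>n. (1/4::real) ^ n)" by simp
  have sumP: "summable (\<lambda>n. P j (z n))" for j
    using Pz_le P_nonneg[OF zV] by (intro summable_comparison_test'[OF geo, of j]) auto
  define x where "x = (\<lambda>k. \<Sum>n. z n k)"
  have xV: "x \<in> V" unfolding x_def by (rule V_series[OF zV sumP])
  have s_sum: "s n k = (\<Sum>i<n. z i k)" for n k
    using sum_lessThan_telescope[of "\<lambda>i. s i k" n] by (simp add: z_def s0)
  have rest: "P j (x - s n) \<le> (1/4) ^ n * (4/3)" if jn: "j \<le> n" for j n
  proof -
    have "x - s n = (\<lambda>k. \<Sum>i. z (i + n) k)"
      using suminf_minus_initial_segment[OF V_series(1)[OF zV sumP]]
      by (auto simp: x_def s_sum fun_eq_iff)
    moreover have "summable (\<lambda>i. P j (z (i + n)))" for j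
      using sumP[of j] by (simp add: summable_iff_shift[of "\<lambda>i. P j (z i)"])
    ultimately have "P j (x - s n) \<le> (\<Sum>i. P j (z (i + n)))"
      using V_series(3)[of "\<lambda>i. z (i + n)"] zV by simp
    also have "\<dots> \<le> (\<Sum>i. (1/4) ^ n * (1/4) ^ i)"
      using Pz_le[of j] jn sumP[of j]
      by (intro suminf_le summable_mult geo)
        (auto simp: summable_iff_shift[of "\<lambda>i. P j (z i)"] power_add[symmetric] add.commute)
    also have "\<dots> = (1/4) ^ n * (4/3)"
      by (subst suminf_mult) (auto simp: suminf_geometric)
    finally show ?thesis .
  qed
  have xM: "x \<in> M"
  proof (rule ccontr)
    assume "x \<notin> M"
    then have "x \<in> V - M" using xV by blast
    moreover have "openin X (V - M)"
      using M(3) by (simp add: closedin_def topspace_seminorm_topology)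
    ultimately obtain j e where e: "e > 0" "\<forall>y\<in>V. P j (y - x) < e \<longrightarrow> y \<in> V - M"
      unfolding openin_koethe_iff by blast
    obtain n0 where "(1/4::real) ^ n0 < e / 2" using real_arch_pow_inv[of "e / 2" "1/4"] e by auto
    moreover have "(1/4::real) ^ (max j n0) \<le> (1/4) ^ n0" by (intro power_decreasing) auto
    ultimately have "P j (s (max j n0) - x) < e"
      using rest[OF max.cobounded1[of j n0]] P_diff_commute[of j x "s (max j n0)"] e(1) by linarith
    then show False using e(2) sV sM by blast
  qed
  have large: "1 \<le> P J ((B ^^ n) x)" if n: "n \<ge> N 0" for n
  proof -
    define i where "i = (LEAST i. n < N (Suc i))"
    have "\<exists>i. n < N (Suc i)" using N_ge(2)[of "Suc n"] by (intro exI[of _ n]) simp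
    then have up: "n < N (Suc i)" unfolding i_def by (rule LeastI_ex)
    have low: "N i \<le> n"
    proof (cases i)
      case (Suc l)
      then show ?thesis using not_less_Least[of l "\<lambda>i. n < N (Suc i)"] by (auto simp: i_def)
    qed (use n in simp)
    obtain q where q: "q \<ge> N (Suc i)" "\<forall>k<q. z i k = 0" "P i (tail q (s i)) \<le> (1/4) ^ i / 4"
      using step[of i] by (auto simp: step_def z_def)
    \<comment> \<open>The hump \<open>z i\<close> vanishes below \<open>q\<close>, hence equals its
      own tail there; the rest of \<open>x\<close> consists of earlier humps and later ones, both
      small beyond \<open>q\<close>.\<close>
    have "z i = tail q x - (tail q (s i) + tail q (x - s (Suc i)))"
      using q(2) by (auto simp: fun_eq_iff tail_def z_def)
    then have "P i (z i) \<le> P i (tail q x) + P i (tail q (s i) + tail q (x - s (Suc i)))"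
      using P_diff[of "tail q x" "tail q (s i) + tail q (x - s (Suc i))" i]
      by (simp add: V_add V_diff V_tail sV xV)
    also have "\<dots> \<le> P i (tail q x) + (P i (tail q (s i)) + P i (x - s (Suc i)))"
      using P_add[of "tail q (s i)" "tail q (x - s (Suc i))" i] P_tail_le[of "x - s (Suc i)" i q]
      by (simp add: V_diff V_tail sV xV)
    also have "\<dots> \<le> P i (tail q x) + ((1/4) ^ i / 4 + (1/4) ^ i / 3)"
      using q(3) rest[of i "Suc i"] by simp
    finally have "(1/4) ^ i * (5/12) \<le> P i (tail q x)" using Pz[of i] by simp
    also have "\<dots> \<le> P i (tail n x)"
      using tail_mono[OF wt_mem[OF xV], of n q] up q(1) by (simp add: P_def wt_tail)
    finally have "(6 * 4 ^ i) * ((1/4) ^ i * (5/12)) \<le> (6 * 4 ^ i) * P i (tail n x)"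
      by (intro mult_left_mono) auto
    also have "\<dots> \<le> P J ((B ^^ n) x)"
      using N0[of i n] low N_ge(1)[of i] by (intro iter_lower[OF xV]) auto
    finally show ?thesis by (simp add: power_one_over)
  qed
  have "x \<noteq> 0"
  proof
    assume "x = 0"
    then have "(B ^^ N 0) x = 0" using iter_coord[OF xV, of "N 0"] by (auto simp: fun_eq_iff)
    then show False using large[of "N 0"] by (simp add: P_zero)
  qed
  \<comment> \<open>The target is the zero vector: a dense orbit comes close to it at arbitrarily
    late times.\<close>
  then obtain n where "n \<ge> N 0" "P J ((B ^^ n) x - 0) < 1"
    using hypercyclic_vector_late[OF hyp[OF xM] V_zero, of 1 "N 0" J] by auto
  then show False using large[of n] by simp
qed

end

section \<open>Construction of a hypercyclic subspace\<close>

context koethe_shift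
begin

lemma finitely_supported:
  fixes x :: "nat \<Rightarrow> 'b::real_normed_field"
  assumes "\<And>h. x h \<noteq> 0 \<Longrightarrow> n \<le> h \<and> h < n + L"
  shows "x \<in> V \<and> P j x \<le> (\<Sum>t<L. norm (x (n + t)) * a j (n + t))"
  using assms
proof (induction L arbitrary: x)
  case 0
  then have x: "x = 0" by (force simp: fun_eq_iff)
  have "P j x = 0" "x \<in> V" unfolding x by (rule P_zero, rule V_zero)
  then show ?case by simp
next
  case (Suc L)
  define x' where "x' = x(n + L := 0)"
  have x': "x' h \<noteq> 0 \<Longrightarrow> n \<le> h \<and> h < n + L" for h
    using Suc.prems[of h] by (auto simp: x'_def split: if_splits)
  have eq: "x = x' + (\<lambda>k. if k = n + L then x (n + L) else 0)" by (auto simp: x'_def)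
  have IH: "x' \<in> V \<and> P j x' \<le> (\<Sum>t<L. norm (x' (n + t)) * a j (n + t))"
    using Suc.IH[OF x'] .
  have "P j x \<le> P j x' + norm (x (n + L)) * a j (n + L)"
    using P_add[of x' "\<lambda>k. if k = n + L then x (n + L) else 0" j] IH
    by (subst eq) (simp add: V_coord_seq P_coord_seq)
  also have "P j x' \<le> (\<Sum>t<L. norm (x (n + t)) * a j (n + t))"
    using IH by (simp add: x'_def)
  finally have "P j x \<le> (\<Sum>t<Suc L. norm (x (n + t)) * a j (n + t))" by simp
  moreover have "x \<in> V" using IH by (subst eq) (simp add: V_add V_coord_seq)
  ultimately show ?case by simp
qed

text \<open>A triple encodes a proportionality between two coordinates, with \<open>c = 0\<close>
  for a vanishing coordinate. The seminorm with index 0 controls every coordinate, so a violated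
  equation stays violated nearby; \<open>b\<close> is the resulting bound for the functional
  \<open>x i - c * x i'\<close>.\<close>

lemma coordinate_equations_closed:
  fixes Q :: "(nat \<times> nat \<times> 'b::real_normed_field) set"
  shows "closedin X {x \<in> V. \<forall>(i, i', c)\<in>Q. x i = c * x i'}"
proof -
  have "\<exists>j. \<exists>e>0. \<forall>y\<in>V. P j (y - x) < e \<longrightarrow> y i \<noteq> c * y i'"
    if x: "x \<in> V" "x i \<noteq> c * x i'" for x :: "nat \<Rightarrow> 'b" and i i' c
  proof -
    define b where "b = 1 / a 0 i + norm c / a 0 i'"
    have b: "0 < b" using entry_pos by (simp add: b_def add_pos_nonneg less_imp_le)
    define e where "e = norm (x i - c * x i') / b"
    have "0 < e" using x b by (simp add: e_def)
    moreover have "y i \<noteq> c * y i'" if y: "y \<in> V" "P 0 (y - x) < e" for y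
    proof
      assume eq: "y i = c * y i'"
      have d: "norm (y h - x h) \<le> P 0 (y - x) / a 0 h" for h
        using P_coord[OF V_diff[OF y(1) x(1)], of h 0] entry_pos[of 0 h] by (simp add: field_simps)
      have "x i - c * x i' = c * (y i' - x i') - (y i - x i)" using eq by (simp add: algebra_simps)
      then have "norm (x i - c * x i') \<le> norm c * norm (y i' - x i') + norm (y i - x i)"
        by (metis norm_triangle_ineq4 norm_mult)
      also have "\<dots> \<le> norm c * (P 0 (y - x) / a 0 i') + P 0 (y - x) / a 0 i"
        by (intro add_mono mult_left_mono d) auto
      also have "\<dots> = P 0 (y - x) * b" by (simp add: b_def algebra_simps)
      also have "\<dots> < e * b" using y b by simp
      finally show False using b by (simp add: e_def)
    qed
    ultimately show ?thesis by blast
  qed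
  note sep = this
  have "\<exists>j. \<exists>e>0. \<forall>y\<in>V. P j (y - x) < e \<longrightarrow> y \<in> V - {x \<in> V. \<forall>(i, i', c)\<in>Q. x i = c * x i'}"
    if xS: "x \<in> V - {x \<in> V. \<forall>(i, i', c)\<in>Q. x i = c * x i'}" for x
  proof -
    obtain i i' c where Q: "(i, i', c) \<in> Q" and x: "x \<in> V" "x i \<noteq> c * x i'"
      using xS by blast
    obtain j e where "e > 0" "\<And>y. y \<in> V \<Longrightarrow> P j (y - x) < e \<Longrightarrow> y i \<noteq> c * y i'"
      using sep[OF x] by blast
    then show ?thesis using Q by (intro exI[of _ j] exI[of _ e]) blast
  qed
  then have "openin X (V - {x \<in> V. \<forall>(i, i', c)\<in>Q. x i = c * x i'})"
    unfolding openin_koethe_iff by blast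
  then show ?thesis unfolding closedin_def topspace_seminorm_topology by blast
qed

lemma coordinate_equations_subspace:
  "seq_subspace {x \<in> V. \<forall>(i, i', c)\<in>Q. x i = c * x i'}"
proof -
  have "(\<lambda>k. 0) \<in> V" using V_zero by (simp add: zero_fun_def)
  then show ?thesis
    unfolding seqs.subspace_def
    by (auto simp: V_add V_scale zero_fun_def algebra_simps split: prod.splits)
qed

text \<open>The vector \<open>u\<close> is the preimage of \<open>d\<close> under the n-th iterate,
  placed on the block starting at \<open>n\<close>. \<open>escape_of_hypercyclic\<close> makes its
  entries tiny in the seminorm \<open>q\<close>, which by continuity dominates the first
  \<open>b\<close> iterates in the seminorm \<open>j\<close>.\<close>

lemma block_exists:
  assumes h: "hypercyclic_vector X B x" and d: "\<And>t. t \<ge> L \<Longrightarrow> d t = 0" and e: "0 < e"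
  shows "\<exists>n>i. \<exists>u. u \<in> V \<and> (\<forall>h. u h \<noteq> 0 \<longrightarrow> n \<le> h \<and> h < n + L) \<and>
    (\<forall>t. \<omega> n t * u (t + n) = d t) \<and> (\<forall>s\<le>b. P j ((B ^^ s) u) \<le> e)"
proof -
  obtain q D where D: "0 < D" "\<And>s k. s \<le> b \<Longrightarrow> W s k * a j k \<le> D * a q (s + k)"
    using iterate_bounded[of b j] by blast
  define S where "S = (\<Sum>t<L. norm (d t))"
  have S: "0 \<le> S" by (simp add: S_def sum_nonneg)
  define e' where "e' = e / (D * (S + 1))"
  have e': "0 < e'" using e D S by (simp add: e'_def)
  obtain n where n: "n \<ge> Suc i" "\<And>k. k < L \<Longrightarrow> a q (n + k) \<le> e' * W n k"
    using escape_of_hypercyclic[OF h e'] by blast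
  define u where "u = (\<lambda>h. if n \<le> h \<and> h < n + L then d (h - n) / \<omega> n (h - n) else 0)"
  have supp: "u h \<noteq> 0 \<Longrightarrow> n \<le> h \<and> h < n + L" for h by (auto simp: u_def split: if_splits)
  have uV: "u \<in> V" using finitely_supported[of u n L] supp by blast
  have "P q u \<le> (\<Sum>t<L. norm (u (n + t)) * a q (n + t))"
    using finitely_supported[of u n L] supp by blast
  also have "\<dots> \<le> (\<Sum>t<L. norm (d t) * e')"
  proof (rule sum_mono)
    fix t assume t: "t \<in> {..<L}"
    have "norm (u (n + t)) * a q (n + t) \<le> norm (u (n + t)) * (e' * W n t)"
      using n(2)[of t] t by (intro mult_left_mono) auto
    also have "\<dots> = norm (d t) * e'"
      using t W_pos[of n t] by (simp add: u_def norm_divide norm_\<omega>)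
    finally show "norm (u (n + t)) * a q (n + t) \<le> norm (d t) * e'" .
  qed
  also have "\<dots> = S * e'" by (simp add: S_def sum_distrib_right)
  finally have Pu: "P q u \<le> S * e'" .
  have "P j ((B ^^ s) u) \<le> e" if "s \<le> b" for s
  proof -
    have "P j ((B ^^ s) u) \<le> D * P q (tail s u)"
      using D that by (intro iter_upper uV) auto
    also have "\<dots> \<le> D * (S * e')"
      using P_tail_le[OF uV, of q s] Pu D by (intro mult_left_mono) auto
    also have "\<dots> \<le> D * ((S + 1) * e')" using D e' by (intro mult_left_mono mult_right_mono) auto
    also have "\<dots> = e" using D S by (simp add: e'_def)
    finally show ?thesis .
  qed
  moreover have "\<omega> n t * u (t + n) = d t" for t
    using \<omega>_nonzero[of n t] d[of t] by (auto simp: u_def)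
  ultimately show ?thesis using n uV supp by (intro exI[of _ n] conjI exI[of _ u]) auto
qed

text \<open>Truncated iterates of the hypercyclic vector form a countable dense family of finitely
  supported targets; \<open>r\<close> codes the pair of iterate and cutoff.\<close>

lemma dense_targets:
  assumes h: "hypercyclic_vector X B x"
  shows "\<exists>(d :: nat \<Rightarrow> nat \<Rightarrow> 'a) L. (\<forall>r. \<forall>t\<ge>L r. d r t = 0) \<and> (\<forall>r. d r \<in> V) \<and>
    (\<forall>y\<in>V. \<forall>j. \<forall>e>0. \<exists>r. P j (d r - y) < e)"
proof -
  have x: "x \<in> V" using h by (simp add: hypercyclic_vector_iff)
  define L where "L = (\<lambda>r. snd (prod_decode r))"
  define d where "d = (\<lambda>r. trunc (L r) ((B ^^ fst (prod_decode r)) x))"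
  have "d r t = 0" if "t \<ge> L r" for r t using that by (simp add: d_def trunc_def)
  moreover have "d r \<in> V" for r unfolding d_def by (intro V_trunc iter_mem x)
  moreover have "\<exists>r. P j (d r - y) < e" if y: "y \<in> V" and e: "0 < e" for y j e
  proof -
    obtain n where n: "P j ((B ^^ n) x - y) < e / 2"
      using hypercyclic_vector_late[OF h y, of "e / 2"] e by auto
    let ?z = "(B ^^ n) x"
    have z: "?z \<in> V" by (intro iter_mem x)
    obtain m where m: "P j (tail m ?z) < e / 2"
      using P_tail_small[OF z, of "e / 2" j] e by auto
    have "trunc m ?z - y = (?z - y) - tail m ?z" by (simp add: trunc_eq_diff diff_diff_eq add.commute)
    then have "P j (trunc m ?z - y) \<le> P j (?z - y) + P j (tail m ?z)"
      using P_diff[OF V_diff[OF z y] V_tail[OF z], of j m] by metis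
    then have "P j (d (prod_encode (n, m)) - y) < e" using n m by (simp add: d_def L_def)
    then show ?thesis by blast
  qed
  ultimately show ?thesis by blast
qed

end

text \<open>The free positions \<open>I k\<close> and the blocks \<open>u k\<close> alternate along
  the index line, and block \<open>k\<close> is attached to the free coordinate
  \<open>I (l k)\<close>. \<open>equi\<close> is equicontinuity of earlier iterates on later free
  unit vectors. Smallness is measured relative to \<open>a 0 (I i)\<close>, so that a block scaled
  by \<open>x (I (l k))\<close> is bounded through the seminorm of \<open>x\<close> with index 0;
  \<open>l_le\<close> makes that position known when the block is chosen.\<close>

locale koethe_blocks = koethe_shift E \<nu> a w B for E \<nu> a and w :: "nat \<Rightarrow> 'a::{real_normed_field,banach}" and B +
  fixes D :: "nat \<Rightarrow> real" and q I n L l :: "nat \<Rightarrow> nat" and u d :: "nat \<Rightarrow> nat \<Rightarrow> 'a"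
  assumes In: "I k < n k" and nI: "n k + L k < I (Suc k)" and l_le: "l k \<le> k"
    and uV: "u k \<in> V" and dV: "d k \<in> V"
    and supp: "u k h \<noteq> 0 \<Longrightarrow> n k \<le> h \<and> h < n k + L k"
    and target: "\<omega> (n k) t * u k (t + n k) = d k t"
    and equi: "k' < k \<Longrightarrow> j \<le> k \<Longrightarrow>
      W (n k') (I k - n k') * a j (I k - n k') \<le> D j * a (q j) (I k)"
    and small0: "i \<le> k \<Longrightarrow> P k (u k) \<le> (1/4) ^ k * a 0 (I i)"
    and small: "k' < k \<Longrightarrow> i \<le> k \<Longrightarrow> P k ((B ^^ n k') (u k)) \<le> (1/4) ^ k * a 0 (I i)"
    and dense: "y \<in> V \<Longrightarrow> 0 < e \<Longrightarrow> \<exists>k\<ge>m. l k = i \<and> P j (d k - y) < e"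

context koethe_shift
begin

lemma koethe_blocks_exist:
  assumes h: "hypercyclic_vector X B x"
    and simul: "\<And>N K. \<exists>i\<ge>K. \<forall>s\<le>N. \<forall>j\<le>N. s \<le> i \<longrightarrow> W s (i - s) * a j (i - s) \<le> D j * a (q j) i"
  shows "\<exists>I n L l u d. koethe_blocks E \<nu> a w B D q I n L l u d"
proof -
  obtain d0 :: "nat \<Rightarrow> nat \<Rightarrow> 'a" and L0 where
    d0: "\<And>r t. t \<ge> L0 r \<Longrightarrow> d0 r t = 0" "\<And>r. d0 r \<in> V" and
    dense: "\<And>y j e. y \<in> V \<Longrightarrow> 0 < e \<Longrightarrow> \<exists>r. P j (d0 r - y) < e"
    using dense_targets[OF h] by metis
  \<comment> \<open>\<open>k\<close> codes a triple: free coordinate, target, and a third component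
    that is ignored, so that each pair of the first two occurs for arbitrarily large
    \<open>k\<close>.\<close>
  define l where "l = (\<lambda>k. fst (prod_decode k))"
  define r where "r = (\<lambda>k. fst (prod_decode (snd (prod_decode k))))"
  define d where "d = (\<lambda>k. d0 (r k))"
  define L where "L = (\<lambda>k. L0 (r k))"
  define good where "good = (\<lambda>k b i n u. b < i \<and> i < n \<and> u \<in> V
    \<and> (\<forall>h. u h \<noteq> 0 \<longrightarrow> n \<le> h \<and> h < n + L k) \<and> (\<forall>t. \<omega> n t * u (t + n) = d k t)
    \<and> (\<forall>s\<le>b. \<forall>j\<le>k. W s (i - s) * a j (i - s) \<le> D j * a (q j) i)
    \<and> (\<forall>s\<le>b. \<forall>i'\<le>i. P k ((B ^^ s) u) \<le> (1/4) ^ k * a 0 i'))"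
  have "\<exists>i n u. good k b i n u" for k b
  proof -
    obtain i where i: "i \<ge> Suc b"
      "\<forall>s\<le>max b k. \<forall>j\<le>max b k. s \<le> i \<longrightarrow> W s (i - s) * a j (i - s) \<le> D j * a (q j) i"
      using simul by blast
    \<comment> \<open>The free positions chosen so far, including the new one, all lie in
      \<open>{..i}\<close>; the minimum serves them simultaneously.\<close>
    define e where "e = (1/4) ^ k * Min (a 0 ` {..i})"
    have e: "0 < e" using entry_pos by (simp add: e_def)
    have ei: "e \<le> (1/4) ^ k * a 0 i'" if "i' \<le> i" for i'
      using that unfolding e_def by (intro mult_left_mono) auto
    have dz: "d k t = 0" if "t \<ge> L k" for t using that d0 by (simp add: d_def L_def)
    obtain n u where "n > i" "u \<in> V" "\<forall>h. u h \<noteq> 0 \<longrightarrow> n \<le> h \<and> h < n + L k"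
      "\<forall>t. \<omega> n t * u (t + n) = d k t" "\<forall>s\<le>b. P k ((B ^^ s) u) \<le> e"
      using block_exists[where L = "L k" and d = "d k" and i = i and b = b and j = k, OF h dz e]
      by blast
    then have "good k b i n u"
      unfolding good_def using i ei by (auto intro: order_trans)
    then show ?thesis by blast
  qed
  then have "\<forall>k b. \<exists>i n u. good k b i n u" by blast
  then obtain fi fn fu where f: "\<And>k b. good k b (fi k b) (fn k b) (fu k b)" by metis
  \<comment> \<open>\<open>b k\<close> is the end of the preceding block, hence bounds every earlier
    exponent \<open>n k'\<close>. The conditions for all \<open>s \<le> b\<close> in
    \<open>good\<close> thus cover those exponents, and \<open>s = 0\<close> covers
    \<open>small0\<close>.\<close>
  define b where "b = rec_nat 0 (\<lambda>k b. fn k b + L k)"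
  define I where "I = (\<lambda>k. fi k (b k))"
  define n where "n = (\<lambda>k. fn k (b k))"
  define u where "u = (\<lambda>k. fu k (b k))"
  have b_Suc: "b (Suc k) = n k + L k" for k by (simp add: b_def n_def)
  have g: "good k (b k) (I k) (n k) (u k)" for k using f by (simp add: I_def n_def u_def)
  have gD: "b k < I k" "I k < n k" "u k \<in> V" for k using g[of k] by (auto simp: good_def)
  have b_mono: "b k \<le> b k'" if "k \<le> k'" for k k'
  proof (rule lift_Suc_mono_le[where f = b, OF _ that])
    show "b i \<le> b (Suc i)" for i using gD(1,2)[of i] b_Suc[of i] by simp
  qed
  have nb: "n k' \<le> b k" if "k' < k" for k k' using b_mono[of "Suc k'" k] b_Suc[of k'] that by simp
  have I_mono: "I i \<le> I k" if "i \<le> k" for i k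
    using that gD[of i] gD[of k] nb[of i k] by (cases "i = k") auto
  have "koethe_blocks E \<nu> a w B D q I n L l u d"
  proof
    show "I k < n k" "u k \<in> V" "d k \<in> V" for k using gD d0 by (auto simp: d_def)
    show "n k + L k < I (Suc k)" for k using gD[of "Suc k"] b_Suc[of k] by simp
    show "l k \<le> k" for k
      using le_prod_encode_1[of "fst (prod_decode k)" "snd (prod_decode k)"] by (simp add: l_def)
    show "u k h \<noteq> 0 \<Longrightarrow> n k \<le> h \<and> h < n k + L k" for k h using g[of k] unfolding good_def by blast
    show "\<omega> (n k) t * u k (t + n k) = d k t" for k t using g[of k] unfolding good_def by blast
    show "W (n k') (I k - n k') * a j (I k - n k') \<le> D j * a (q j) (I k)" if "k' < k" "j \<le> k" for k k' j
      using g[of k] nb[OF that(1)] that(2) unfolding good_def by blast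
    show "P k ((B ^^ n k') (u k)) \<le> (1/4) ^ k * a 0 (I i)" if "k' < k" "i \<le> k" for k k' i
      using g[of k] nb[OF that(1)] I_mono[OF that(2)] unfolding good_def by blast
    show "P k (u k) \<le> (1/4) ^ k * a 0 (I i)" if "i \<le> k" for k i
    proof -
      have "\<forall>s\<le>b k. \<forall>i'\<le>I k. P k ((B ^^ s) (u k)) \<le> (1/4) ^ k * a 0 i'"
        using g[of k] unfolding good_def by blast
      from this[rule_format, of 0 "I i"] show ?thesis using I_mono[OF that] by simp
    qed
    show "\<exists>k\<ge>m. l k = i \<and> P j (d k - y) < e" if y: "y \<in> V" and e: "0 < e" for y j e i m
    proof -
      obtain r0 where "P j (d0 r0 - y) < e" using dense[OF y e] by blast
      moreover have "m \<le> prod_encode (i, prod_encode (r0, m))"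
        using le_prod_encode_2[of m r0] le_prod_encode_2[of "prod_encode (r0, m)" i] by linarith
      ultimately show ?thesis
        by (intro exI[of _ "prod_encode (i, prod_encode (r0, m))"]) (simp add: l_def d_def r_def)
    qed
  qed
  then show ?thesis by blast
qed

end

text \<open>Biorthogonality to the coordinates \<open>I m\<close> gives independence: all
  \<open>z m'\<close> other than \<open>z m\<close> lie in the kernel of the coordinate
  \<open>I m\<close>.\<close>

lemma infinite_dimensional:
  fixes z :: "nat \<Rightarrow> nat \<Rightarrow> 'b::field"
  assumes M: "seq_subspace M" "\<And>m. z m \<in> M" and z: "\<And>m m'. z m (I m') = (if m' = m then 1 else 0)"
  shows "\<nexists>S. finite S \<and> seq_span S = M"
proof
  assume "\<exists>S. finite S \<and> seq_span S = M"
  then obtain S where S: "finite S" "seq_span S = M" by blast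
  have inj: "inj z"
  proof (rule injI)
    fix m m' assume "z m = z m'"
    then have "z m (I m) = z m' (I m)" by simp
    then show "m = m'" using z[of m m] z[of m' m] by (auto split: if_splits)
  qed
  have "\<not> seqs.dependent (range z)"
  proof
    assume "seqs.dependent (range z)"
    then obtain m where m: "z m \<in> seq_span (range z - {z m})"
      unfolding seqs.dependent_def by blast
    have "seq_span (range z - {z m}) \<subseteq> {x. x (I m) = 0}"
    proof (rule seqs.span_minimal)
      show "range z - {z m} \<subseteq> {x. x (I m) = 0}" using z by (auto split: if_splits)
      show "seq_subspace {x. x (I m) = 0}" by (auto simp: seqs.subspace_def)
    qed
    then show False using m z[of m m] by auto
  qed
  moreover have "range z \<subseteq> seq_span S" using M S by auto
  ultimately have "finite (range z)" using seqs.independent_span_bound[OF S(1)] by blast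
  then show False using inj by (simp add: finite_image_iff)
qed

context koethe_blocks
begin

text \<open>In \<open>M\<close> the coordinates in \<open>range I\<close> are free. The blocks \<open>u k\<close>, scaled by the coordinate
  \<open>I (l k)\<close>, are superimposed on them: they are disjoint from each other and from \<open>range I\<close>, so that
  \<open>M\<close> is given by equations between two coordinates and is closed. The iterate \<open>n k\<close> moves the
  block \<open>u k\<close> to the target \<open>d k\<close> and makes everything else small.\<close>

lemma hypercyclic_subspace_exists:
  "\<exists>M. hypercyclic_subspace X B M"
proof -
  define blk where "blk = (\<lambda>k. {n k..<n k + L k})"
  have In_lt: "n k + L k < I k'" if "k < k'" for k k'
  proof -
    have "I (Suc k) \<le> I k'"
    proof (rule lift_Suc_mono_le[where f = I])
      show "I i \<le> I (Suc i)" for i using In[of i] nI[of i] by simp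
    qed (use that in simp)
    then show ?thesis using nI[of k] by simp
  qed
  have I_less: "I k < I k'" if "k < k'" for k k'
    using In_lt[OF that] In[of k] by simp
  have I_inj: "I k = I k' \<longleftrightarrow> k = k'" for k k'
    using I_less[of k k'] I_less[of k' k] by (metis less_irrefl linorder_neqE_nat)
  have I_blk: "I k' \<notin> blk k" for k k'
    using In_lt[of k k'] In[of k] I_less[of k' k] by (cases "k < k'"; cases "k' = k") (auto simp: blk_def)
  have blk_order: "h \<in> blk k \<Longrightarrow> h' \<in> blk k' \<Longrightarrow> k < k' \<Longrightarrow> h < h'" for h h' k k'
    using In_lt[of k k'] In[of k'] by (auto simp: blk_def)
  have blk_unique: "h \<in> blk k \<Longrightarrow> h \<in> blk k' \<Longrightarrow> k = k'" for h k k'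
    using blk_order[of h k h k'] blk_order[of h k' h k] by (metis less_irrefl linorder_neqE_nat)
  have u_off: "u k h = 0" if "h \<notin> blk k" for k h
    using supp[of k h] that by (auto simp: blk_def)
  have n_ge: "k \<le> n k" for k
  proof -
    have "k \<le> I k"
    proof (induction k)
      case (Suc k)
      then show ?case using I_less[of k "Suc k"] by simp
    qed simp
    then show ?thesis using In[of k] by simp
  qed

  define Eq where "Eq = {(h, I (l k), u k h) |h k. h \<in> blk k}
    \<union> {(h, h, 0) |h. h \<notin> range I \<and> (\<forall>k. h \<notin> blk k)}"
  define M where "M = {x \<in> V. \<forall>(i, i', c)\<in>Eq. x i = c * x i'}"
  have M_iff: "x \<in> M \<longleftrightarrow> x \<in> V \<and> (\<forall>k. \<forall>h\<in>blk k. x h = u k h * x (I (l k)))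
      \<and> (\<forall>h. h \<notin> range I \<longrightarrow> (\<forall>k. h \<notin> blk k) \<longrightarrow> x h = 0)" for x
    unfolding M_def Eq_def ball_Un by (auto simp: Ball_def)
  have M_sub: "seq_subspace M" unfolding M_def by (rule coordinate_equations_subspace)
  have M_closed: "closedin X M" unfolding M_def by (rule coordinate_equations_closed)

  have geo4: "summable (\<lambda>k. (1/4::real) ^ k * c)" for c by (simp add: summable_mult2)
  define F where "F = (\<lambda>m k. if l k = m then u k else 0)"
  have FV: "F m k \<in> V" for m k by (simp add: F_def uV V_zero)
  have FP: "summable (\<lambda>k. P j (F m k))" for j m
  proof (rule summable_comparison_test'[OF geo4[of "a 0 (I m)"], of j])
    fix k assume k: "j \<le> k"
    have "P j (F m k) \<le> (1/4) ^ k * a 0 (I m)"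
    proof (cases "l k = m")
      case True
      have "P j (u k) \<le> P k (u k)" by (rule P_mono[OF uV k])
      then show ?thesis using True small0[OF l_le[of k]] by (simp add: F_def)
    next
      case False
      then show ?thesis using entry_pos[of 0 "I m"] by (simp add: F_def P_zero)
    qed
    then show "norm (P j (F m k)) \<le> (1/4) ^ k * a 0 (I m)"
      using P_nonneg[OF FV, of j m k] by simp
  qed
  \<comment> \<open>The element of \<open>M\<close> whose only nonzero free coordinate is a 1 at
    \<open>I m\<close>, completed by all blocks attached to \<open>m\<close>.\<close>
  define z where "z = (\<lambda>m. unit_seq (I m) + (\<lambda>h. \<Sum>k. F m k h))"
  have zV: "z m \<in> V" for m
    unfolding z_def using V_series(2)[OF FV FP] by (intro V_add unit_seq_mem)
  have sum_blk: "(\<Sum>k. F m k h) = F m k h" if "h \<in> blk k" for m k h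
  proof -
    have "F m k' h = 0" if "k' \<noteq> k" for k'
      using that blk_unique[OF \<open>h \<in> blk k\<close>, of k'] u_off[of h k'] by (auto simp: F_def)
    then show ?thesis using suminf_finite[of "{k}" "\<lambda>k. F m k h"] by simp
  qed
  have sum_off: "(\<Sum>k. F m k h) = 0" if "\<And>k. h \<notin> blk k" for m h
    using that u_off by (simp add: F_def if_distribR cong: if_cong)
  have z_I: "z m (I m') = (if m' = m then 1 else 0)" for m m'
    using sum_off[of "I m'" m] I_blk by (simp add: z_def unit_seq_def I_inj)
  have z_blk: "z m h = u k h * (if l k = m then 1 else 0)" if "h \<in> blk k" for m h k
    using sum_blk[OF that, of m] that I_blk[of m k] by (auto simp: z_def unit_seq_def F_def)
  have zM: "z m \<in> M" for m
    unfolding M_iff using zV sum_off[of _ m]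
    by (auto simp: z_I z_blk) (auto simp: z_def unit_seq_def)
  have M_inf: "\<nexists>S. finite S \<and> seq_span S = M"
    using infinite_dimensional[OF M_sub zM z_I] .

  have approx: "\<exists>k0. \<forall>k\<ge>k0. P j ((B ^^ n k) x - (\<lambda>t. x (I (l k)) * d k t)) < e"
    if xM: "x \<in> M" and e: "0 < e" for x j e
  proof -
    have xV: "x \<in> V" using xM by (simp add: M_iff)
    \<comment> \<open>\<open>x\<close> is \<open>x1\<close> plus the scaled blocks. The iterate
      \<open>n k\<close> annihilates the blocks before the k-th, which end below \<open>n k\<close>,
      and maps the k-th one to \<open>x (I (l k))\<close> times \<open>d k\<close>; the later ones
      give \<open>G k\<close>.\<close>
    define x1 where "x1 = (\<lambda>h. if h \<in> range I then x h else 0)"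
    have "wt j x1 \<in> E" for j
      using wt_nonneg by (intro conjunct1[OF P_dominated[OF wt_mem[OF xV]]]) (auto simp: x1_def wt_def less_imp_le[OF entry_pos])
    then have x1V: "x1 \<in> V" by (simp add: V_def)
    define G where "G = (\<lambda>k k'. if k' \<le> k then 0 else (\<lambda>t. x (I (l k')) * (B ^^ n k) (u k') t))"
    have GV: "G k k' \<in> V" for k k' by (simp add: G_def V_zero V_scale iter_mem uV)
    define C where "C = P 0 x"
    have GP: "P i (G k k') \<le> (1/2) ^ k * C * (1/2) ^ k'" if ik: "k' \<le> k \<or> i \<le> k'" for i k k'
    proof (cases "k' \<le> k")
      case True
      then show ?thesis using P_nonneg[OF xV, of 0] by (simp add: G_def P_zero C_def)
    next
      case False
      let ?i = "I (l k')"
      have "P i (G k k') = norm (x ?i) * P i ((B ^^ n k) (u k'))"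
        using False by (simp add: G_def P_scale iter_mem uV)
      also have "P i ((B ^^ n k) (u k')) \<le> P k' ((B ^^ n k) (u k'))"
        using False ik by (intro P_mono iter_mem uV) simp
      also have "\<dots> \<le> (1/4) ^ k' * a 0 ?i" using False by (intro small l_le) simp
      finally have "P i (G k k') \<le> norm (x ?i) * ((1/4) ^ k' * a 0 ?i)"
        by (simp add: mult_left_mono)
      also have "\<dots> = (1/4) ^ k' * (norm (x ?i) * a 0 ?i)" by simp
      also have "\<dots> \<le> (1/4) ^ k' * C"
        unfolding C_def by (intro mult_left_mono P_coord xV) simp
      \<comment> \<open>One half of the decay is kept for summation over \<open>k'\<close>; the
        other, since \<open>k' > k\<close>, provides a factor tending to 0 with
        \<open>k\<close>.\<close>
      also have "(1/4::real) ^ k' = (1/2) ^ k' * (1/2) ^ k'"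
        by (simp add: power_mult_distrib[symmetric])
      also have "(1/2) ^ k' * (1/2) ^ k' * C \<le> (1/2) ^ k * (1/2) ^ k' * C"
        using False P_nonneg[OF xV, of 0]
        by (intro mult_right_mono power_decreasing) (auto simp: C_def)
      finally show ?thesis by (simp add: mult_ac)
    qed
    have geo2: "summable (\<lambda>k'. c * (1/2::real) ^ k')" for c by (simp add: summable_mult)
    have split: "(B ^^ n k) x - (\<lambda>t. x (I (l k)) * d k t) = (B ^^ n k) x1 + (\<lambda>t. \<Sum>k'. G k k' t)" for k
    proof
      fix t
      define h where "h = t + n k"
      have lhs: "((B ^^ n k) x - (\<lambda>t. x (I (l k)) * d k t)) t = \<omega> (n k) t * (x h - x (I (l k)) * u k h)"
        by (simp add: iter_coord xV target[symmetric] h_def algebra_simps)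
      have Gt: "G k k' t = (if k' \<le> k then 0 else \<omega> (n k) t * (x (I (l k')) * u k' h))" for k'
        by (simp add: G_def iter_coord uV h_def)
      have "\<omega> (n k) t * (x h - x (I (l k)) * u k h) = \<omega> (n k) t * x1 h + (\<Sum>k'. G k k' t)"
      proof -
        consider (I) "h \<in> range I" | (blk) k' where "h \<in> blk k'" "h \<notin> range I"
          | (off) "h \<notin> range I" "\<And>k. h \<notin> blk k" by blast
        then show ?thesis
        proof cases
          case I
          then have "u k' h = 0" for k' using I_blk u_off by blast
          then show ?thesis using I by (simp add: Gt x1_def cong: if_cong)
        next
          case (blk k')
          have xh: "x h = u k' h * x (I (l k'))" using xM blk(1) unfolding M_iff by blast
          have off: "u k'' h = 0" if "k'' \<noteq> k'" for k''
            using that blk_unique[OF blk(1), of k''] u_off[of h k''] by blast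
          have "k \<le> k'"
            using blk(1) In_lt[of k' k] In[of k] by (force simp: blk_def h_def not_less[symmetric])
          have "(\<Sum>k''. G k k'' t) = G k k' t"
            using suminf_finite[of "{k'}" "\<lambda>k''. G k k'' t"] off by (simp add: Gt)
          moreover have "x1 h = 0" using blk(2) by (simp add: x1_def)
          ultimately show ?thesis
            using off[of k] \<open>k \<le> k'\<close> xh Gt[of k'] by (cases "k' = k") (simp_all add: mult_ac)
        next
          case off
          then show ?thesis using xM u_off by (simp add: Gt x1_def M_iff cong: if_cong)
        qed
      qed
      then show "((B ^^ n k) x - (\<lambda>t. x (I (l k)) * d k t)) t = ((B ^^ n k) x1 + (\<lambda>t. \<Sum>k'. G k k' t)) t"
        using lhs by (simp add: iter_coord x1V h_def)
    qed
    \<comment> \<open>Positivity of \<open>D j\<close> is not among the assumptions; it follows from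
      \<open>equi\<close>, whose left side is positive.\<close>
    have Dpos: "0 < D j"
    proof -
      have "0 < W (n j) (I (Suc j) - n j) * a j (I (Suc j) - n j)"
        by (intro mult_pos_pos W_pos a_pos)
      also have "\<dots> \<le> D j * a (q j) (I (Suc j))" by (intro equi) auto
      finally show ?thesis using a_pos[of "q j" "I (Suc j)"] by (simp add: zero_less_mult_iff)
    qed
    have first: "P j ((B ^^ n k) x1) \<le> D j * P (q j) (tail (n k) x1)" if jk: "j \<le> k" for k
    proof (rule iter_upper[OF x1V less_imp_le[OF Dpos]])
      fix t assume "x1 (t + n k) \<noteq> 0"
      then obtain m where m: "t + n k = I m" by (auto simp: x1_def split: if_splits)
      then have "I k < I m" using In[of k] by simp
      then have "k < m" using I_less[of m k] by (metis I_inj less_asym' linorder_neqE_nat)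
      moreover have "t = I m - n k" "n k + t = I m" using m by auto
      ultimately show "W (n k) t * a j t \<le> D j * a (q j) (n k + t)"
        using equi[of k m j] jk by simp
    qed
    have sm: "summable (\<lambda>k'. P i (G k k'))" for i k
      proof (rule summable_comparison_test'[OF geo2, of i])
        show "norm (P i (G k k')) \<le> (1/2) ^ k * C * (1/2) ^ k'" if "i \<le> k'" for k'
          using GP[of k' k i] P_nonneg[OF GV, of i k k'] that by simp
      qed
    have sumV: "(\<lambda>t. \<Sum>k'. G k k' t) \<in> V" for k by (rule V_series(2)[OF GV sm])
    have second: "P j (\<lambda>t. \<Sum>k'. G k k' t) \<le> (1/2) ^ k * C * 2" if jk: "j \<le> k" for k
    proof -
      have "P j (\<lambda>t. \<Sum>k'. G k k' t) \<le> (\<Sum>k'. P j (G k k'))" by (rule V_series(3)[OF GV sm])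
      also have "\<dots> \<le> (\<Sum>k'. (1/2) ^ k * C * (1/2) ^ k')"
        using jk by (intro suminf_le GP sm geo2) linarith
      also have "\<dots> = (1/2) ^ k * C * 2"
        by (subst suminf_mult) (auto simp: suminf_geometric)
      finally show ?thesis .
    qed
    obtain k1 where k1: "\<And>k. k \<ge> k1 \<Longrightarrow> P (q j) (tail k x1) < e / 2 / D j"
      using P_tail_small[OF x1V, of "e / 2 / D j" "q j"] e Dpos by auto
    have lim: "(\<lambda>k. (1/2) ^ k * C * 2) \<longlonglongrightarrow> 0 * C * 2"
      by (intro tendsto_intros) auto
    have "\<forall>\<^sub>F k in sequentially. (1/2) ^ k * C * 2 < e / 2"
      by (rule order_tendstoD(2)[OF lim]) (use e in simp)
    then obtain k2 where k2: "\<And>k. k \<ge> k2 \<Longrightarrow> (1/2) ^ k * C * 2 < e / 2"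
      unfolding eventually_sequentially by blast
    have "P j ((B ^^ n k) x - (\<lambda>t. x (I (l k)) * d k t)) < e" if k: "k \<ge> max j (max k1 k2)" for k
    proof -
      have "P j ((B ^^ n k) x - (\<lambda>t. x (I (l k)) * d k t))
          \<le> P j ((B ^^ n k) x1) + P j (\<lambda>t. \<Sum>k'. G k k' t)"
        unfolding split using sumV by (intro P_add iter_mem x1V)
      also have "\<dots> \<le> D j * P (q j) (tail (n k) x1) + (1/2) ^ k * C * 2"
        using k by (intro add_mono first second) auto
      also have "\<dots> < D j * (e / 2 / D j) + e / 2"
        using k1[of "n k"] k2[of k] n_ge[of k] k Dpos
        by (intro add_strict_mono mult_strict_left_mono) auto
      also have "\<dots> = e" using Dpos by simp
      finally show ?thesis .
    qed
    then show ?thesis by blast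
  qed

  have hyp: "hypercyclic_vector X B x" if xM: "x \<in> M" and x0: "x \<noteq> 0" for x
  proof -
    have xV: "x \<in> V" using xM by (simp add: M_iff)
    obtain m where m: "x (I m) \<noteq> 0"
    proof -
      have "x = 0" if "\<And>m. x (I m) = 0"
      proof
        fix h
        consider m where "h = I m" | k where "h \<in> blk k" | "h \<notin> range I" "\<And>k. h \<notin> blk k" by blast
        then show "x h = 0 h" using xM that by cases (auto simp: M_iff)
      qed
      then show ?thesis using x0 that by blast
    qed
    have "\<exists>n\<ge>1. (B ^^ n) x \<in> V \<and> P j ((B ^^ n) x - y) < e" if y: "y \<in> V" and e: "0 < e" for y j e
    proof -
      let ?c = "x (I m)"
      \<comment> \<open>Restricting to \<open>l k = m\<close> keeps the coefficient of
        \<open>d k\<close> equal to the fixed nonzero number \<open>x (I m)\<close>, so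
        approximating the rescaled target suffices.\<close>
      define y' where "y' = (\<lambda>k. inverse ?c * y k)"
      have y'V: "y' \<in> V" unfolding y'_def by (rule V_scale[OF y])
      have y: "y = (\<lambda>k. ?c * y' k)" using m by (simp add: y'_def fun_eq_iff)
      obtain k0 where k0: "\<And>k. k \<ge> k0 \<Longrightarrow> P j ((B ^^ n k) x - (\<lambda>t. x (I (l k)) * d k t)) < e / 2"
        using approx[OF xM, of "e / 2" j] e by auto
      have "0 < e / 2 / norm ?c" using e m by simp
      then obtain k where k: "k \<ge> k0" "l k = m" "P j (d k - y') < e / 2 / norm ?c"
        using dense[OF y'V] by blast
      have dy: "d k - y' \<in> V" by (intro V_diff dV y'V)
      have V1: "(B ^^ n k) x - (\<lambda>t. ?c * d k t) \<in> V" by (intro V_diff V_scale dV iter_mem xV)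
      have "(B ^^ n k) x - y = ((B ^^ n k) x - (\<lambda>t. ?c * d k t)) + (\<lambda>t. ?c * (d k - y') t)"
        by (subst y) (auto simp: fun_eq_iff algebra_simps)
      then have "P j ((B ^^ n k) x - y)
          \<le> P j ((B ^^ n k) x - (\<lambda>t. ?c * d k t)) + P j (\<lambda>t. ?c * (d k - y') t)"
        using P_add[OF V1 V_scale[OF dy], of j ?c] by metis
      also have "\<dots> < e / 2 + norm ?c * (e / 2 / norm ?c)"
        using k k0[of k] m P_scale[OF dy, of j ?c]
        by (intro add_strict_mono) (auto simp del: times_divide_eq_right intro!: mult_strict_left_mono)
      also have "\<dots> = e" using m by simp
      finally show ?thesis
        using In[of k] iter_mem[OF xV] by (intro exI[of _ "n k"]) auto
    qed
    then show ?thesis unfolding hypercyclic_vector_iff using xV by blast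
  qed
  show ?thesis
    unfolding hypercyclic_subspace_def using M_sub M_closed M_inf hyp by blast
qed

end

section \<open>The characterization\<close>

lemma SUP_INF_le_one_imp_less_infinity:
  "(SUP n\<in>A. INF k. f n k) \<le> (1 :: ereal) \<Longrightarrow> (SUP n\<in>A. INF k. f n k) < \<infinity>"
  by (rule le_less_trans) auto

lemma SUP_INF_finite_imp_bound:
  fixes f :: "nat \<Rightarrow> nat \<Rightarrow> real"
  assumes "(SUP n\<in>{1..}. INF k. ereal (f n k)) < \<infinity>"
  obtains C where "\<And>n. n \<ge> 1 \<Longrightarrow> \<exists>k. f n k \<le> C"
proof -
  obtain C where C: "(SUP n\<in>{1..}. INF k. ereal (f n k)) < ereal C"
    using assms less_PInf_Ex_of_nat by auto
  show thesis
  proof (rule that)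
    fix n :: nat assume "n \<ge> 1"
    then have "(INF k. ereal (f n k)) < ereal C"
      using le_less_trans[OF SUP_upper C, of n] by auto
    then show "\<exists>k. f n k \<le> C" by (auto simp: INF_less_iff intro: less_imp_le)
  qed
qed

text \<open>A number strictly between 1 and the infimum is an expansion factor valid for all
  \<open>k\<close> at once; its powers tend to infinity, which is what \<open>weight_growth\<close>
  needs.\<close>

lemma not_SUP_INF_le_one_imp_bound:
  fixes f :: "nat \<Rightarrow> nat \<Rightarrow> real"
  assumes "\<not> (SUP n\<in>{1..}. INF k. ereal (f n k)) \<le> 1"
  shows "\<exists>n\<ge>1. \<exists>c>1. \<forall>k. c \<le> f n k"
proof -
  obtain n where n: "n \<ge> 1" "1 < (INF k. ereal (f n k))"
    using assms by (auto simp: not_le less_SUP_iff)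
  obtain c where c: "1 < ereal c" "ereal c < (INF k. ereal (f n k))"
    using ereal_dense2[OF n(2)] by auto
  have "c \<le> f n k" for k
    using less_le_trans[OF c(2) INF_lower[of k UNIV "\<lambda>k. ereal (f n k)"]] by simp
  then show ?thesis using n c by (auto simp: one_ereal_def)
qed

context koethe_shift
begin

text \<open>The supremum over \<open>n\<close> makes \<open>C\<close> uniform, whereas the threshold
  \<open>K\<close> comes from each limsup separately and depends on \<open>n\<close>.\<close>

lemma limsup_finite_imp_bound:
  assumes "(SUP n. limsup (\<lambda>k. ereal (a j k * a m (n + k) / (a J k * a m' (n + k))))) < \<infinity>"
  shows "\<exists>C. \<forall>n. \<exists>K. \<forall>k\<ge>K. a j k * a m (n + k) \<le> C * (a J k * a m' (n + k))"
proof -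
  obtain C where C: "(SUP n. limsup (\<lambda>k. ereal (a j k * a m (n + k) / (a J k * a m' (n + k))))) < ereal C"
    using assms less_PInf_Ex_of_nat by auto
  have "\<exists>K. \<forall>k\<ge>K. a j k * a m (n + k) \<le> C * (a J k * a m' (n + k))" for n
  proof -
    have "limsup (\<lambda>k. ereal (a j k * a m (n + k) / (a J k * a m' (n + k)))) < ereal C"
      by (rule le_less_trans[OF SUP_upper C]) simp
    then have "\<forall>\<^sub>F k in sequentially. ereal (a j k * a m (n + k) / (a J k * a m' (n + k))) < ereal C"
      by (rule Limsup_lessD)
    then obtain K where "\<And>k. k \<ge> K \<Longrightarrow> a j k * a m (n + k) / (a J k * a m' (n + k)) < C"
      unfolding eventually_sequentially by auto
    then show ?thesis
      using a_pos by (intro exI[of _ K] allI impI) (simp add: pos_divide_less_eq less_imp_le)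
  qed
  then show ?thesis by blast
qed

text \<open>Finiteness is not shown directly to imply the bound 1. The cycle runs from the bound 1
  to finiteness, from there to a hypercyclic subspace, and from the subspace back to the bound 1,
  possibly with another \<open>m\<close>.\<close>

lemma hypercyclic_subspace_characterization:
  assumes hyp: "hypercyclic X B"
    and H: "\<And>m j. \<exists>m'. (SUP n. limsup (\<lambda>k. ereal ((a j k * a m (n + k)) / (a J k * a m' (n + k))))) < \<infinity>"
  defines "f \<equiv> \<lambda>m n k. (\<Prod>\<nu>=1..n. norm (w (\<nu> + k))) * a J k / a m (n + k)"
  shows "((\<exists>M. hypercyclic_subspace X B M) \<longleftrightarrow> (\<exists>m. (SUP n\<in>{1..}. INF k. ereal (f m n k)) \<le> 1))
       \<and> ((\<exists>M. hypercyclic_subspace X B M) \<longleftrightarrow> (\<exists>m. (SUP n\<in>{1..}. INF k. ereal (f m n k)) < \<infinity>))"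
proof -
  have f: "f m n k = W n k * a J k / a m (n + k)" for m n k by (simp add: f_def W_def)
  have A_imp_B: "(SUP n\<in>{1..}. INF k. ereal (f m n k)) < \<infinity>"
    if "(SUP n\<in>{1..}. INF k. ereal (f m n k)) \<le> 1" for m
    using that by (rule SUP_INF_le_one_imp_less_infinity)
  have B_imp: "\<exists>M. hypercyclic_subspace X B M"
    if B: "(SUP n\<in>{1..}. INF k. ereal (f m n k)) < \<infinity>" for m
  proof -
    obtain C where C: "\<And>n. n \<ge> 1 \<Longrightarrow> \<exists>k. f m n k \<le> C" using SUP_INF_finite_imp_bound[OF B] by blast
    have C': "\<exists>k. W n k * a J k \<le> C * a m (n + k)" if "n \<ge> 1" for n
      using C[OF that] a_pos[of m] by (auto simp: f pos_divide_le_eq)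
    obtain x where x: "hypercyclic_vector X B x" using hyp by (auto simp: hypercyclic_def)
    have H': "\<exists>m' C. \<forall>n. \<exists>K. \<forall>k\<ge>K. a j k * a m (n + k) \<le> C * (a J k * a m' (n + k))" for m j
    proof -
      obtain m' where "(SUP n. limsup (\<lambda>k. ereal ((a j k * a m (n + k)) / (a J k * a m' (n + k))))) < \<infinity>"
        using H by blast
      then show ?thesis by (intro exI[of _ m'] limsup_finite_imp_bound)
    qed
    obtain q D where qD:
      "\<And>N K. \<exists>i\<ge>K. \<forall>s\<le>N. \<forall>j\<le>N. s \<le> i \<longrightarrow> W s (i - s) * a j (i - s) \<le> D j * a (q j) i"
      using simultaneous_bounds[OF C' escape_of_hypercyclic[OF x] H'] by blast
    obtain I n L l u d where "koethe_blocks E \<nu> a w B D q I n L l u d"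
      using koethe_blocks_exist[OF x qD] by blast
    then show ?thesis by (rule koethe_blocks.hypercyclic_subspace_exists)
  qed
  have imp_A: "\<exists>m. (SUP n\<in>{1..}. INF k. ereal (f m n k)) \<le> 1"
    if M: "hypercyclic_subspace X B M" for M
  proof (rule ccontr)
    assume no: "\<not> ?thesis"
    \<comment> \<open>The set \<open>{0}\<close> keeps the growth estimate valid from
      \<open>k = 0\<close> on; the gliding hump needs it for every \<open>k\<close>.\<close>
    have "\<exists>n\<ge>1. \<exists>c>1. \<exists>K\<in>{0}. \<forall>k\<ge>K. c * a m (n + k) \<le> W n k * a J k" for m
    proof -
      obtain n c where "n \<ge> 1" "c > 1" "\<And>k. c \<le> f m n k"
        using no not_SUP_INF_le_one_imp_bound[of "f m"] by blast
      then show ?thesis using a_pos[of m] by (auto simp: f pos_le_divide_eq)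
    qed
    then have "\<exists>N. \<exists>K\<in>{0}. \<forall>n\<ge>N. \<forall>k\<ge>K. C * a m (n + k) \<le> W n k * a J k" if "0 < C" for m C
      using that by (intro weight_growth) auto
    then have "\<not> hypercyclic_subspace X B M" by (intro no_hypercyclic_subspace) auto
    then show False using M by contradiction
  qed
  show ?thesis using A_imp_B B_imp imp_A by blast
qed

end

section \<open>Identification of the concrete spaces, and the theorem\<close>

lemma lambda_space_eq:
  assumes "p \<ge> 1" "koethe_matrix a"
  shows "koethe_space (lp_cone p) (lp_norm p) a"
    and "(lambda_space p a :: (nat \<Rightarrow> 'a::real_normed_field) topology) = seminorm_topology (koethe_space.V (lp_cone p) a) (koethe_space.P (lp_norm p) a)"
proof -
  show "koethe_space (lp_cone p) (lp_norm p) a"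
    by (intro koethe_space.intro koethe_space_axioms.intro solid_space_lp assms)
  then interpret koethe_space "lp_cone p" "lp_norm p" a .
  show "lambda_space p a = (X :: (nat \<Rightarrow> 'a) topology)"
  proof -
    have "lambda_set p a = (V :: (nat \<Rightarrow> 'a) set)"
      unfolding V_def by (auto simp: lambda_set_def lp_cone_def wt_def less_imp_le entry_pos)
    moreover have "lambda_norm p a = (P :: nat \<Rightarrow> (nat \<Rightarrow> 'a) \<Rightarrow> real)"
      by (simp add: fun_eq_iff lambda_norm_def P_def lp_norm_def wt_def)
    ultimately show ?thesis by (simp add: lambda_space_def)
  qed
qed

lemma c0_space_eq:
  assumes "koethe_matrix a"
  shows "koethe_space c0_cone sup_norm a"
    and "(c0_space a :: (nat \<Rightarrow> 'a::real_normed_field) topology) = seminorm_topology (koethe_space.V c0_cone a) (koethe_space.P sup_norm a)"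
proof -
  show "koethe_space c0_cone sup_norm a"
    by (intro koethe_space.intro koethe_space_axioms.intro solid_space_c0 assms)
  then interpret koethe_space c0_cone sup_norm a .
  show "c0_space a = (X :: (nat \<Rightarrow> 'a) topology)"
  proof -
    have "c0_set a = (V :: (nat \<Rightarrow> 'a) set)"
      unfolding V_def by (auto simp: c0_set_def c0_cone_def wt_def less_imp_le entry_pos)
    moreover have "c0_norm a = (P :: nat \<Rightarrow> (nat \<Rightarrow> 'a) \<Rightarrow> real)"
      by (simp add: fun_eq_iff c0_norm_def P_def sup_norm_def wt_def)
    ultimately show ?thesis by (simp add: c0_space_def)
  qed
qed

theorem theorem4p5:
  fixes a :: "nat \<Rightarrow> nat \<Rightarrow> real"
    and w :: "nat \<Rightarrow> 'a::{real_normed_field, euclidean_space}"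
    and X :: "(nat \<Rightarrow> 'a) topology"
    and B :: "(nat \<Rightarrow> 'a) \<Rightarrow> (nat \<Rightarrow> 'a)"
    and J :: nat
  assumes "koethe_matrix a"
    and "(\<exists>p\<ge>1. X = lambda_space p a) \<or> X = c0_space a"
    and "weighted_shift X w B"
    and "hypercyclic X B"
    and "\<And>m j. \<exists>m'. (SUP n. limsup (\<lambda>k. ereal ((a j k * a m (n + k)) / (a J k * a m' (n + k))))) < \<infinity>"
  shows "((\<exists>M. hypercyclic_subspace X B M) \<longleftrightarrow>
           (\<exists>m. (SUP n\<in>{1..}. INF k. ereal ((\<Prod>\<nu>=1..n. norm (w (\<nu> + k))) * a J k / a m (n + k))) \<le> 1))
       \<and> ((\<exists>M. hypercyclic_subspace X B M) \<longleftrightarrow>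
           (\<exists>m. (SUP n\<in>{1..}. INF k. ereal ((\<Prod>\<nu>=1..n. norm (w (\<nu> + k))) * a J k / a m (n + k))) < \<infinity>))"
proof -
  obtain E \<nu> where E: "koethe_space E \<nu> a"
    and X: "X = seminorm_topology (koethe_space.V E a) (koethe_space.P \<nu> a)"
    using assms(2) lambda_space_eq[OF _ assms(1)] c0_space_eq[OF assms(1)] by metis
  have "koethe_shift E \<nu> a w B"
    using E assms(3) unfolding X by (intro koethe_shift.intro koethe_shift_axioms.intro)
  from koethe_shift.hypercyclic_subspace_characterization[OF this, of J] assms(4,5)
  show ?thesis unfolding X by blast
qed

end
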